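(* Let $\mathbf{k}=(k_1,\dots,k_m)$ be an index and $t$ an indeterminate. Then $$\sum_{i=0}^{\infty}\left(\widetilde{\pounds}_{\widehat{\mathcal{A}},(\{1\}^i,\mathbf{k})}^{\star}(t)-\frac12\zeta_{\widehat{\mathcal{A}}}^{\star}(\{1\}^i,\mathbf{k})\right)\boldsymbol{p}^i=\sum_{i=0}^{\infty}\left(\widetilde{\pounds}_{\widehat{\mathcal{A}},(\{1\}^i,\mathbf{k}^{\vee})}^{\star}(1-t)-\frac12\zeta_{\widehat{\mathcal{A}}}^{\star}(\{1\}^i,\mathbf{k}^{\vee})\right)\boldsymbol{p}^i$$ in the ring $\widehat{\mathcal{A}}_{\mathbb{Z}[t]}=\varprojlim_n\left(\prod_p(\mathbb{Z}/p^n\mathbb{Z})[t]\right)/\left(\bigoplus_p(\mathbb{Z}/p^n\mathbb{Z})[t]\right)$.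
   Context: An index is a tuple $\mathbf{k}=(k_1,\dots,k_m)$ of positive integers ($m\ge 1$). $(\{1\}^i,\mathbf{k})$ denotes $(\underbrace{1,\dots,1}_{i},k_1,\dots,k_m)$. Hoffman dual: let $W$ be the free monoid on $\{0,1\}$. To an index $\mathbf{k}$ associate the word $w(\mathbf{k})=\underbrace{0\cdots0}_{k_1-1}1\underbrace{0\cdots0}_{k_2-1}1\cdots1\underbrace{0\cdots0}_{k_m-1}1$; $w$ is a bijection from the set of all indices onto $W1$ (words ending in $1$). Let $\tau\colon W\to W$ be the monoid homomorphism with $\tau(0)=1$, $\tau(1)=0$. The Hoffman dual $\mathbf{k}^{\vee}$ is the index determined by $w(\mathbf{k}^{\vee})=\tau(w(\mathbf{k})1^{-1})1$ (delete the last letter $1$, exchange $0$ and $1$, append $1$). Rings: in $\widehat{\mathcal{A}}_{\mathbb{Z}[t]}$, $p$ runs over all prime numbers. Each quotient $\mathcal{A}_{n,\mathbb{Z}[t]}=\left(\prod_p(\mathbb{Z}/p^n\mathbb{Z})[t]\right)/\left(\bigoplus_p(\mathbb{Z}/p^n\mathbb{Z})[t]\right)$ is discrete and $\widehat{\mathcal{A}}_{\mathbb{Z}[t]}$ has the projective limit topology; it is a $\mathbb{Q}$-algebra. There is a natural surjection $\pi\colon\prod_p\widehat{\mathbb{Z}[t]}_p\to\widehat{\mathcal{A}}_{\mathbb{Z}[t]}$, where $\widehat{\mathbb{Z}[t]}_p=\varprojlim_n\mathbb{Z}[t]/p^n\mathbb{Z}[t]$, induced by reduction mod $p^n$ in each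 component; since components at finitely many primes do not matter, $\pi$ may be applied to families defined for all but finitely many $p$. Put $\boldsymbol{p}=\pi((p)_p)$. The topology is the $\boldsymbol{p}$-adic topology, for which the ring is complete, and infinite sums are taken in this topology. Finite star-multiple polylogarithms and zeta-star values: for an index $\mathbf{k}=(k_1,\dots,k_m)$, $$\widetilde{\pounds}_{\widehat{\mathcal{A}},\mathbf{k}}^{\star}(t)=\pi\left(\left(\sum_{p-1\ge n_1\ge\cdots\ge n_m\ge1}\frac{t^{n_m}}{n_1^{k_1}\cdots n_m^{k_m}}\right)_p\right),\qquad \zeta_{\widehat{\mathcal{A}}}^{\star}(\mathbf{k})=\pi\left(\left(\sum_{p-1\ge n_1\ge\cdots\ge n_m\ge1}\frac{1}{n_1^{k_1}\cdots n_m^{k_m}}\right)_p\right),$$ as elements of $\widehat{\mathcal{A}}_{\mathbb{Z}[t]}$; $\widetilde{\pounds}_{\widehat{\mathcal{A}},\mathbf{k}}^{\star}(1-t)$ is obtained by substituting $1-t$ for $t$ in every $p$-component. *)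

theory Defs
  imports
    "HOL-Number_Theory.Number_Theory"
    "HOL-Number_Theory.Modular_Inverse"
    "HOL-Computational_Algebra.Polynomial"
    "HOL-Algebra.UnivPoly"
    "HOL-Algebra.QuotRing"
    "HOL-Analysis.Function_Topology"
    "HOL-Analysis.Abstract_Topological_Spaces"
begin

section \<open>Indices and the Hoffman dual\<close>

definition is_index :: "nat list \<Rightarrow> bool" where
  "is_index k \<longleftrightarrow> k \<noteq> [] \<and> (\<forall>x\<in>set k. 1 \<le> x)"

text \<open>Words over the alphabet \<open>{0,1}\<close> are lists of Booleans, \<open>False\<close> being the
  letter 0 and \<open>True\<close> the letter 1; the automorphism exchanging the letters is
  then \<^term>\<open>map Not\<close>.\<close>

definition index_word :: "nat list \<Rightarrow> bool list" where
  "index_word k = concat (map (\<lambda>x. replicate (x - 1) False @ [True]) k)"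

definition hoffman_dual :: "nat list \<Rightarrow> nat list" where
  "hoffman_dual k =
     (THE l. is_index l \<and> index_word l = map Not (butlast (index_word k)) @ [True])"


section \<open>Products and projective limits of rings\<close>

definition product_ring :: "'i set \<Rightarrow> ('i \<Rightarrow> ('a, 'b) ring_scheme) \<Rightarrow> ('i \<Rightarrow> 'a) ring" where
  "product_ring I R =
     \<lparr>carrier = (\<Pi>\<^sub>E i\<in>I. carrier (R i)),
      monoid.mult = (\<lambda>x y. \<lambda>i\<in>I. x i \<otimes>\<^bsub>R i\<^esub> y i),
      one = (\<lambda>i\<in>I. \<one>\<^bsub>R i\<^esub>),
      zero = (\<lambda>i\<in>I. \<zero>\<^bsub>R i\<^esub>),
      add = (\<lambda>x y. \<lambda>i\<in>I. x i \<oplus>\<^bsub>R i\<^esub> y i)\<rparr>"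

definition direct_sum :: "'i set \<Rightarrow> ('i \<Rightarrow> ('a, 'b) ring_scheme) \<Rightarrow> ('i \<Rightarrow> 'a) set" where
  "direct_sum I R =
     {x \<in> carrier (product_ring I R). finite {i \<in> I. x i \<noteq> \<zero>\<^bsub>R i\<^esub>}}"

text \<open>The limit of a tower \<open>R 1 \<leftarrow> R 2 \<leftarrow> R 3 \<leftarrow> \<dots>\<close>, where \<open>\<phi> n\<close> maps
  \<open>R (Suc n)\<close> to \<open>R n\<close>. The value of the tower at 0 is not used.\<close>

definition proj_limit ::
    "(nat \<Rightarrow> ('a, 'b) ring_scheme) \<Rightarrow> (nat \<Rightarrow> 'a \<Rightarrow> 'a) \<Rightarrow> (nat \<Rightarrow> 'a) ring" where
  "proj_limit R \<phi> =
     (product_ring {1..} R)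
       \<lparr>carrier := {x \<in> carrier (product_ring {1..} R). \<forall>n\<ge>1. \<phi> n (x (Suc n)) = x n}\<rparr>"

definition proj_limit_topology ::
    "(nat \<Rightarrow> ('a, 'b) ring_scheme) \<Rightarrow> (nat \<Rightarrow> 'a \<Rightarrow> 'a) \<Rightarrow> (nat \<Rightarrow> 'a) topology" where
  "proj_limit_topology R \<phi> =
     subtopology (product_topology (\<lambda>n. discrete_topology (carrier (R n))) {1..})
       (carrier (proj_limit R \<phi>))"


section \<open>The polynomial ring over the integers modulo powers of primes\<close>

abbreviation primes :: "nat set" where
  "primes \<equiv> {p. prime p}"

definition Zpn_poly :: "nat \<Rightarrow> nat \<Rightarrow> (int, nat \<Rightarrow> int) up_ring" where
  "Zpn_poly n p = UP (residue_ring (int p ^ n))"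

definition Zpn_reduce :: "nat \<Rightarrow> nat \<Rightarrow> (nat \<Rightarrow> int) \<Rightarrow> (nat \<Rightarrow> int)" where
  "Zpn_reduce n p f = (\<lambda>j. f j mod int p ^ n)"

text \<open>The \<open>p\<close>-adic completion of \<open>\<int>[t]\<close>.\<close>

definition Zt_hat :: "nat \<Rightarrow> (nat \<Rightarrow> nat \<Rightarrow> int) ring" where
  "Zt_hat p = proj_limit (\<lambda>n. Zpn_poly n p) (\<lambda>n. Zpn_reduce n p)"

text \<open>The next two functions give the canonical map from \<open>\<int>\<^sub>(\<^sub>p\<^sub>)[t]\<close>, the rational
  polynomials whose coefficients have denominators prime to \<open>p\<close>, to the \<open>p\<close>-adic
  completion of \<open>\<int>[t]\<close>: a coefficient \<open>a/b\<close> is sent to \<open>a\<close> times the inverse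
  of \<open>b\<close> modulo \<open>p\<^sup>n\<close>. They are meaningful on such polynomials only.\<close>

definition rat_mod :: "int \<Rightarrow> rat \<Rightarrow> int" where
  "rat_mod m q = (case quotient_of q of (a, b) \<Rightarrow> (a * modular_inverse m b) mod m)"

definition Zt_hat_of_poly :: "nat \<Rightarrow> rat poly \<Rightarrow> (nat \<Rightarrow> nat \<Rightarrow> int)" where
  "Zt_hat_of_poly p f = (\<lambda>n\<in>{1..}. \<lambda>j. rat_mod (int p ^ n) (poly.coeff f j))"


section \<open>The ring \<open>\<A>\<close>-hat over \<open>\<int>[t]\<close>\<close>

definition A_ring :: "nat \<Rightarrow> (nat \<Rightarrow> nat \<Rightarrow> int) set ring" where
  "A_ring n = product_ring primes (Zpn_poly n) Quot direct_sum primes (Zpn_poly n)"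

definition A_class :: "nat \<Rightarrow> (nat \<Rightarrow> nat \<Rightarrow> int) \<Rightarrow> (nat \<Rightarrow> nat \<Rightarrow> int) set" where
  "A_class n x =
     direct_sum primes (Zpn_poly n) +>\<^bsub>product_ring primes (Zpn_poly n)\<^esub> (\<lambda>p\<in>primes. x p)"

text \<open>The transition map: reduce any representative of the coset. All representatives
  give the same coset, so the image below is a singleton.\<close>

definition A_transition ::
    "nat \<Rightarrow> (nat \<Rightarrow> nat \<Rightarrow> int) set \<Rightarrow> (nat \<Rightarrow> nat \<Rightarrow> int) set" where
  "A_transition n X = the_elem ((\<lambda>x. A_class n (\<lambda>p. Zpn_reduce n p (x p))) ` X)"

definition A_hat :: "(nat \<Rightarrow> (nat \<Rightarrow> nat \<Rightarrow> int) set) ring" where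
  "A_hat = proj_limit A_ring A_transition"

definition A_hat_topology :: "(nat \<Rightarrow> (nat \<Rightarrow> nat \<Rightarrow> int) set) topology" where
  "A_hat_topology = proj_limit_topology A_ring A_transition"

text \<open>The natural map from the product of all \<^term>\<open>Zt_hat p\<close>, \<open>p\<close> prime.\<close>

definition A_hat_proj ::
    "(nat \<Rightarrow> (nat \<Rightarrow> nat \<Rightarrow> int)) \<Rightarrow> (nat \<Rightarrow> (nat \<Rightarrow> nat \<Rightarrow> int) set)" where
  "A_hat_proj x = (\<lambda>n\<in>{1..}. A_class n (\<lambda>p. x p n))"

definition p_hat :: "nat \<Rightarrow> (nat \<Rightarrow> nat \<Rightarrow> int) set" where
  "p_hat = A_hat_proj (\<lambda>p. Zt_hat_of_poly p (of_nat p))"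

definition half_hat :: "nat \<Rightarrow> (nat \<Rightarrow> nat \<Rightarrow> int) set" where
  "half_hat = inv\<^bsub>A_hat\<^esub> (\<one>\<^bsub>A_hat\<^esub> \<oplus>\<^bsub>A_hat\<^esub> \<one>\<^bsub>A_hat\<^esub>)"

text \<open>\<open>A_hat_sums f S\<close>: the series with terms \<open>f 0, f 1, \<dots>\<close> converges to \<open>S\<close>.\<close>

definition A_hat_sums ::
    "(nat \<Rightarrow> nat \<Rightarrow> (nat \<Rightarrow> nat \<Rightarrow> int) set) \<Rightarrow> (nat \<Rightarrow> (nat \<Rightarrow> nat \<Rightarrow> int) set) \<Rightarrow> bool"
  where
  "A_hat_sums f S \<longleftrightarrow>
     limitin A_hat_topology (\<lambda>N. \<Oplus>\<^bsub>A_hat\<^esub>i\<in>{..<N}. f i) S sequentially"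

lemma A_hat_sums_unique: "A_hat_sums f S \<Longrightarrow> A_hat_sums f S' \<Longrightarrow> S = S'"
  unfolding A_hat_sums_def A_hat_topology_def proj_limit_topology_def
  by (erule limitin_Hausdorff_unique)
     (auto intro!: Hausdorff_space_subtopology simp: Hausdorff_space_product_topology)


section \<open>Finite star-multiple polylogarithms and zeta-star values\<close>

definition star_tuples :: "nat \<Rightarrow> nat \<Rightarrow> nat list set" where
  "star_tuples p m = {ns. length ns = m \<and> sorted_wrt (\<ge>) ns \<and> set ns \<subseteq> {1..p - 1}}"

definition index_power :: "nat list \<Rightarrow> nat list \<Rightarrow> rat" where
  "index_power ns k = (\<Prod>i<length k. of_nat (ns ! i) ^ (k ! i))"

text \<open>The argument \<open>u\<close> is what is substituted for the indeterminate: \<open>t\<close> or \<open>1 - t\<close>.\<close>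

definition polylog_star :: "nat list \<Rightarrow> rat poly \<Rightarrow> (nat \<Rightarrow> (nat \<Rightarrow> nat \<Rightarrow> int) set)" where
  "polylog_star k u =
     A_hat_proj (\<lambda>p. Zt_hat_of_poly p
       (\<Sum>ns\<in>star_tuples p (length k). smult (1 / index_power ns k) (u ^ last ns)))"

definition zeta_star :: "nat list \<Rightarrow> (nat \<Rightarrow> (nat \<Rightarrow> nat \<Rightarrow> int) set)" where
  "zeta_star k =
     A_hat_proj (\<lambda>p. Zt_hat_of_poly p
       [:\<Sum>ns\<in>star_tuples p (length k). 1 / index_power ns k:])"

definition star_series_term ::
    "nat list \<Rightarrow> rat poly \<Rightarrow> nat \<Rightarrow> (nat \<Rightarrow> (nat \<Rightarrow> nat \<Rightarrow> int) set)" where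
  "star_series_term k u i =
     (polylog_star (replicate i 1 @ k) u
        \<ominus>\<^bsub>A_hat\<^esub> half_hat \<otimes>\<^bsub>A_hat\<^esub> zeta_star (replicate i 1 @ k))
     \<otimes>\<^bsub>A_hat\<^esub> p_hat [^]\<^bsub>A_hat\<^esub> i"

end

theory Submission
  imports Defs "HOL-Algebra.Subrings"
begin

text \<open>
  Let \<open>s k u n\<close> be the sum of \<open>u ^ n\<^sub>m / (n\<^sub>1 ^ k\<^sub>1 \<dots> n\<^sub>m ^ k\<^sub>m)\<close> over \<open>n = n\<^sub>1 \<ge> \<dots> \<ge> n\<^sub>m \<ge> 1\<close>. In
  the \<open>p\<close>-component, summing over the leading ones weights \<open>s k u a\<close> with the \<open>p\<close>-adically
  convergent product of the \<open>1 / (1 - p / n)\<close>, \<open>a \<le> n < p\<close>, which is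
  \<open>(-1) ^ (p - a) * (p - 1 choose a - 1)\<close>. Hence for odd \<open>p\<close> the series of polylogarithms is
  \<open>F k u = T (s k u) p - s k u p\<close>, where \<open>T f N\<close> is the sum of
  \<open>(-1) ^ (n - 1) * (N - 1 choose n - 1) * f n\<close> over \<open>1 \<le> n \<le> N\<close>. The transform \<open>T\<close> interchanges
  \<open>f n \<mapsto> f n / n\<close> with \<open>f n \<mapsto> (f 1 + \<dots> + f n) / n\<close>, the operators attached to the letters 0 and 1,
  and it sends \<open>u ^ n / n\<close> to \<open>(1 - (1 - u) ^ n) / n\<close>. With \<open>k'\<close> the dual index, \<open>T (s k u)\<close> is
  \<open>s k' 1 - s k' (1 - u)\<close>, and \<open>F k u - F k 1 / 2 = F k' (1 - u) - F k' 1 / 2\<close> is an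
  identity of rational polynomials.
\<close>

section \<open>The binomial transform and the Hoffman dual\<close>

text \<open>At n = 0 the convention 1 / 0 = 0 makes the value 0, so identities between these
  operators hold there trivially.\<close>

definition letter_op :: "bool \<Rightarrow> (nat \<Rightarrow> rat poly) \<Rightarrow> nat \<Rightarrow> rat poly" where
  "letter_op b f n = smult (1 / of_nat n) (if b then \<Sum>j=1..n. f j else f n)"

abbreviation word_op :: "bool list \<Rightarrow> (nat \<Rightarrow> rat poly) \<Rightarrow> nat \<Rightarrow> rat poly" where
  "word_op \<equiv> foldr letter_op"

text \<open>The classical self-inverse binomial transform, shifted from sequences starting at index
  0 to sequences starting at index 1.\<close>

definition binom_transform :: "(nat \<Rightarrow> rat poly) \<Rightarrow> nat \<Rightarrow> rat poly" where
  "binom_transform f N =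
     (\<Sum>n=1..N. smult ((-1) ^ (n - 1) * of_nat ((N - 1) choose (n - 1))) (f n))"

lemma smult_sum_right: "smult c (\<Sum>x\<in>A. f x) = (\<Sum>x\<in>A. smult c (f x))"
  by (induction A rule: infinite_finite_induct) (simp_all add: smult_add_right)

text \<open>Absorption: n * (N choose n) = N * (N - 1 choose n - 1). Keeping the factor N on the
  left lets the statement cover N = 0 too.\<close>

lemma binom_transform_divide:
  "smult (of_nat N) (binom_transform (\<lambda>n. smult (1 / of_nat n) (f n)) N) =
     (\<Sum>n=1..N. smult ((-1) ^ (n - 1) * of_nat (N choose n)) (f n))"
  unfolding binom_transform_def smult_sum_right smult_smult
proof (rule sum.cong[OF refl])
  fix n assume "n \<in> {1..N}"
  then have n: "0 < n" by simp
  have "of_nat n * (of_nat (N choose n) :: rat) = of_nat N * of_nat ((N - 1) choose (n - 1))"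
    unfolding of_nat_mult[symmetric] times_binomial_minus1_eq[OF n] ..
  then have "of_nat N * ((-1) ^ (n - 1) * of_nat ((N - 1) choose (n - 1))) * (1 / of_nat n) =
      ((-1) ^ (n - 1) * of_nat (N choose n) :: rat)"
    using n by (simp add: field_simps)
  then show "smult (of_nat N * ((-1) ^ (n - 1) * of_nat ((N - 1) choose (n - 1)) * (1 / of_nat n))) (f n)
      = smult ((-1) ^ (n - 1) * of_nat (N choose n)) (f n)"
    by (simp add: mult.assoc)
qed

text \<open>By Pascal's rule the left side grows by \<open>binom_transform f (Suc N)\<close> when
  \<open>N\<close> becomes \<open>Suc N\<close>. Together with absorption this turns the operator of
  letter 0 into that of letter 1.\<close>

lemma sum_choose_binom_transform:
  "(\<Sum>n=1..N. smult ((-1) ^ (n - 1) * of_nat (N choose n)) (f n)) =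
     (\<Sum>j=1..N. binom_transform f j)"
proof (induction N)
  case (Suc N)
  have *: "(Suc N choose n) = (N choose n) + (N choose (n - 1))" if "n \<in> {1..Suc N}" for n
    using that by (cases n) auto
  have "(\<Sum>n=1..Suc N. smult ((-1) ^ (n - 1) * of_nat (Suc N choose n)) (f n)) =
      (\<Sum>n=1..Suc N. smult ((-1) ^ (n - 1) * of_nat (N choose n)) (f n)
         + smult ((-1) ^ (n - 1) * of_nat (N choose (n - 1))) (f n))"
    by (rule sum.cong) (simp_all only: * of_nat_add distrib_left smult_add_left)
  \<comment> \<open>In the first half the term n = Suc N drops out, since N choose Suc N is
    0.\<close>
  also have "\<dots> = (\<Sum>n=1..N. smult ((-1) ^ (n - 1) * of_nat (N choose n)) (f n))
      + binom_transform f (Suc N)"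
    by (simp add: sum.distrib binom_transform_def binomial_eq_0)
  finally show ?case
    by (simp only: Suc.IH sum.cl_ivl_Suc) simp
qed simp

text \<open>Abel summation, with the weights given as differences of \<open>c\<close>.\<close>

lemma sum_by_parts:
  fixes c :: "nat \<Rightarrow> rat"
  shows "(\<Sum>n=1..M. smult (c (n - 1) - c n) (\<Sum>j=1..n. f j)) =
     (\<Sum>n=1..M. smult (c (n - 1)) (f n)) - smult (c M) (\<Sum>j=1..M. f j)"
proof (induction M)
  case (Suc M)
  then show ?case
    by (simp add: smult_add_right smult_diff_left algebra_simps)
qed simp

text \<open>With M = N - 1 and c n = (-1)^n (M choose n), Pascal's rule gives the weight as c (n -
  1) - c n. Summation by parts then removes the inner partial sums, and the boundary term vanishes
  because c N = 0. This turns letter 1 into letter 0.\<close>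

lemma sum_choose_partial_sums:
  "(\<Sum>n=1..N. smult ((-1) ^ (n - 1) * of_nat (N choose n)) (\<Sum>j=1..n. f j)) =
     binom_transform f N"
proof (cases N)
  case (Suc M)
  define c where "c n = ((-1) ^ n * of_nat (M choose n) :: rat)" for n
  have c: "(-1) ^ (n - 1) * of_nat (N choose n) = c (n - 1) - c n" if "n \<in> {1..N}" for n
    using that by (cases n) (auto simp: c_def Suc algebra_simps)
  have "c N = 0"
    by (simp add: c_def Suc binomial_eq_0)
  have "(\<Sum>n=1..N. smult ((-1) ^ (n - 1) * of_nat (N choose n)) (\<Sum>j=1..n. f j)) =
      (\<Sum>n=1..N. smult (c (n - 1) - c n) (\<Sum>j=1..n. f j))"
    by (rule sum.cong) (simp_all only: c)
  also have "\<dots> = (\<Sum>n=1..N. smult (c (n - 1)) (f n))"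
    unfolding sum_by_parts \<open>c N = 0\<close> by simp
  finally show ?thesis
    by (simp add: binom_transform_def c_def Suc)
qed (simp add: binom_transform_def)

text \<open>After multiplication by N, absorption leaves a sum weighted by N choose n. The two
  preceding summation identities evaluate it, one for each letter.\<close>

lemma binom_transform_letter_op:
  "binom_transform (letter_op b f) = letter_op (\<not> b) (binom_transform f)"
proof
  fix N
  show "binom_transform (letter_op b f) N = letter_op (\<not> b) (binom_transform f) N"
  proof (cases "N = 0")
    case True
    then show ?thesis by (simp add: binom_transform_def letter_op_def)
  next
    case False
    have "smult (of_nat N) (binom_transform (letter_op b f) N) =
        (\<Sum>n=1..N. smult ((-1) ^ (n - 1) * of_nat (N choose n)) (if b then \<Sum>j=1..n. f j else f n))"
      unfolding binom_transform_divide[symmetric] by (simp add: letter_op_def[abs_def])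
    also have "\<dots> = (if b then binom_transform f N else \<Sum>j=1..N. binom_transform f j)"
      using sum_choose_partial_sums[of N f] sum_choose_binom_transform[of N f] by (cases b) simp_all
    finally have "smult (1 / of_nat N) (smult (of_nat N) (binom_transform (letter_op b f) N)) =
        letter_op (\<not> b) (binom_transform f) N"
      unfolding letter_op_def by simp
    then show ?thesis
      using False by simp
  qed
qed

lemma binom_transform_word_op:
  "binom_transform (word_op w f) = word_op (map Not w) (binom_transform f)"
  by (induction w) (simp_all add: binom_transform_letter_op)

lemma word_op_diff:
  "word_op w (\<lambda>n. f n - g n) = (\<lambda>n. word_op w f n - word_op w g n)"
  by (induction w)
    (simp_all add: letter_op_def fun_eq_iff sum_subtractf smult_diff_right)

section \<open>The initial sequence u^n / n and nested star sums as words in the letter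
  operators\<close>

definition power_seq :: "rat poly \<Rightarrow> nat \<Rightarrow> rat poly" where
  "power_seq u n = smult (1 / of_nat n) (u ^ n)"

text \<open>The binomial theorem for (1 - u)^N: the constant term 1 is moved to the other side and
  everything is divided by N.\<close>

lemma binom_transform_power_seq:
  "binom_transform (power_seq u) = (\<lambda>n. power_seq 1 n - power_seq (1 - u) n)"
proof
  fix N
  show "binom_transform (power_seq u) N = power_seq 1 N - power_seq (1 - u) N"
  proof (cases "N = 0")
    case True
    then show ?thesis by (simp add: binom_transform_def power_seq_def)
  next
    case False
    have "(1 - u) ^ N = (\<Sum>n\<le>N. of_nat (N choose n) * (- u) ^ n)"
      using binomial_ring[of "- u" 1 N] by simp
    also have "\<dots> = (\<Sum>n=0..N. smult ((-1) ^ n * of_nat (N choose n)) (u ^ n))"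
      unfolding atMost_atLeast0
    proof (intro sum.cong refl)
      fix n
      show "of_nat (N choose n) * (- u) ^ n = smult ((-1) ^ n * of_nat (N choose n)) (u ^ n)"
        by (cases "even n") (simp_all add: of_nat_poly)
    qed
    also have "\<dots> = 1 + (\<Sum>n=1..N. smult ((-1) ^ n * of_nat (N choose n)) (u ^ n))"
      by (simp add: sum.atLeast_Suc_atMost)
    also have "(\<Sum>n=1..N. smult ((-1) ^ n * of_nat (N choose n)) (u ^ n)) =
        - (\<Sum>n=1..N. smult ((-1) ^ (n - 1) * of_nat (N choose n)) (u ^ n))"
      unfolding sum_negf[symmetric]
    proof (rule sum.cong[OF refl])
      fix n assume "n \<in> {1..N}"
      then show "smult ((-1) ^ n * of_nat (N choose n)) (u ^ n) =
          - smult ((-1) ^ (n - 1) * of_nat (N choose n)) (u ^ n)"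
        by (cases n) auto
    qed
    also have "(\<Sum>n=1..N. smult ((-1) ^ (n - 1) * of_nat (N choose n)) (u ^ n)) =
        smult (of_nat N) (binom_transform (power_seq u) N)"
      unfolding binom_transform_divide[symmetric] by (simp add: power_seq_def[abs_def])
    finally have "smult (of_nat N) (binom_transform (power_seq u) N) = 1 - (1 - u) ^ N"
      by simp
    then have "smult (1 / of_nat N) (smult (of_nat N) (binom_transform (power_seq u) N)) =
        smult (1 / of_nat N) (1 - (1 - u) ^ N)"
      by simp
    then show ?thesis
      using False by (simp add: power_seq_def smult_diff_right)
  qed
qed

text \<open>The star sum with its largest variable fixed to n. The last letter 1 of the word is
  accounted for by \<open>power_seq u\<close>, which supplies u^n and one factor 1 / n. What remains
  is exactly the part of the word on which the Hoffman dual exchanges the letters.\<close>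

definition inner_star :: "nat list \<Rightarrow> rat poly \<Rightarrow> nat \<Rightarrow> rat poly" where
  "inner_star k u = word_op (butlast (index_word k)) (power_seq u)"

lemma word_op_replicate_False:
  "word_op (replicate m False) f n = smult (1 / of_nat n ^ m) (f n)"
  by (induction m) (simp_all add: letter_op_def del: foldr_replicate)

lemma inner_star_single: "1 \<le> x \<Longrightarrow> inner_star [x] u n = smult (1 / of_nat n ^ x) (u ^ n)"
  by (cases x) (simp_all add: inner_star_def index_word_def butlast_append word_op_replicate_False
      power_seq_def mult.commute del: foldr_replicate)

lemma index_word_nonempty: "k \<noteq> [] \<Longrightarrow> index_word k \<noteq> []"
  by (cases k) (auto simp: index_word_def)

text \<open>The x - 1 letters 0 and the letter 1 of the first block each contribute a factor 1 / n,
  and the letter 1 also sums over the next variable.\<close>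

lemma inner_star_Cons:
  assumes "1 \<le> x" "k \<noteq> []"
  shows "inner_star (x # k) u n = smult (1 / of_nat n ^ x) (\<Sum>j=1..n. inner_star k u j)"
proof -
  have "butlast (index_word (x # k)) =
      replicate (x - 1) False @ True # butlast (index_word k)"
    using index_word_nonempty[OF assms(2)] by (simp add: index_word_def butlast_append)
  then show ?thesis
    using assms(1) by (cases x) (simp_all add: inner_star_def foldr_append word_op_replicate_False letter_op_def
        mult.commute del: foldr_replicate)
qed

text \<open>The largest entry is split off. Entries of \<open>star_tuples p m\<close> are at most p
  - 1, so the bound n on the remaining ones appears as \<open>Suc n\<close>.\<close>

lemma star_tuples_Suc:
  "star_tuples (Suc c) (Suc m) = (\<Union>n\<in>{1..c}. (#) n ` star_tuples (Suc n) m)"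
proof (intro equalityI subsetI)
  fix ns assume "ns \<in> star_tuples (Suc c) (Suc m)"
  then obtain n ns' where "ns = n # ns'" "n \<in> {1..c}" "ns' \<in> star_tuples (Suc n) m"
    by (cases ns) (fastforce simp: star_tuples_def)+
  then show "ns \<in> (\<Union>n\<in>{1..c}. (#) n ` star_tuples (Suc n) m)"
    by blast
next
  fix ns assume "ns \<in> (\<Union>n\<in>{1..c}. (#) n ` star_tuples (Suc n) m)"
  then show "ns \<in> star_tuples (Suc c) (Suc m)"
    by (force simp: star_tuples_def)
qed

lemma star_tuples_0 [simp]: "star_tuples p 0 = {[]}"
  by (auto simp: star_tuples_def)

lemma finite_star_tuples [simp]: "finite (star_tuples p m)"
  by (rule finite_subset[OF _ finite_lists_length_eq[of "{1..p - 1}" m]])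
    (auto simp: star_tuples_def)

lemma index_power_Cons: "index_power (n # ns) (x # k) = of_nat n ^ x * index_power ns k"
  by (simp add: index_power_def prod.lessThan_Suc_shift del: prod.lessThan_Suc)

lemma sum_star_tuples_Suc:
  "(\<Sum>ns\<in>star_tuples (Suc c) (Suc m). g ns) =
     (\<Sum>n=1..c. \<Sum>ns\<in>star_tuples (Suc n) m. g (n # ns))"
  unfolding star_tuples_Suc
  by (subst sum.UNION_disjoint) (auto simp: sum.reindex)

text \<open>Induction on the index: splitting off the largest variable n matches the recursion of
  \<open>inner_star\<close> over the first block.\<close>

lemma sum_star_tuples_eq_inner_star:
  assumes "is_index k"
  shows "(\<Sum>ns\<in>star_tuples (Suc c) (length k). smult (1 / index_power ns k) (u ^ last ns)) =
     (\<Sum>n=1..c. inner_star k u n)"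
  using assms
proof (induction k arbitrary: c)
  case (Cons x k)
  then have x: "1 \<le> x" by (simp add: is_index_def)
  show ?case
  \<comment> \<open>The case is separate because \<open>last (n # ns)\<close> is \<open>n\<close>
    itself when \<open>ns\<close> is empty; otherwise it is \<open>last ns\<close>.\<close>
  proof (cases "k = []")
    case True
    then show ?thesis
      using x by (simp add: sum_star_tuples_Suc inner_star_single index_power_Cons)
        (simp add: index_power_def)
  next
    case False
    then have "is_index k" using Cons.prems by (simp add: is_index_def)
    have "(\<Sum>ns\<in>star_tuples (Suc n) (length k). smult (1 / index_power (n # ns) (x # k)) (u ^ last (n # ns)))
        = inner_star (x # k) u n" for n
    proof -
      have "(\<Sum>ns\<in>star_tuples (Suc n) (length k). smult (1 / index_power (n # ns) (x # k)) (u ^ last (n # ns)))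
        = (\<Sum>ns\<in>star_tuples (Suc n) (length k). smult (1 / of_nat n ^ x)
              (smult (1 / index_power ns k) (u ^ last ns)))"
      proof (rule sum.cong[OF refl])
        fix ns assume "ns \<in> star_tuples (Suc n) (length k)"
        then have "ns \<noteq> []" using False by (auto simp: star_tuples_def)
        then show "smult (1 / index_power (n # ns) (x # k)) (u ^ last (n # ns)) =
            smult (1 / of_nat n ^ x) (smult (1 / index_power ns k) (u ^ last ns))"
          by (simp add: index_power_Cons)
      qed
      then show ?thesis
        by (simp only: Cons.IH[OF \<open>is_index k\<close>] inner_star_Cons[OF x False] smult_sum_right[symmetric])
    qed
    then show ?thesis
      by (simp add: sum_star_tuples_Suc)
  qed
qed (simp add: is_index_def)

section \<open>Existence and uniqueness of the Hoffman dual\<close>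

lemma index_word_surj: "\<exists>l. is_index l \<and> index_word l = w @ [True]"
proof (induction w)
  case Nil
  show ?case by (rule exI[of _ "[1]"]) (simp add: is_index_def index_word_def)
next
  case (Cons b w)
  then obtain l where l: "is_index l" "index_word l = w @ [True]" by blast
  then obtain x l' where x: "l = x # l'" "1 \<le> x"
    by (cases l) (auto simp: is_index_def)
  \<comment> \<open>A new first letter 1 opens a block of its own, hence a new entry 1; a new first
    letter 0 lengthens the first block, hence raises the first entry by one.\<close>
  show ?case
  proof (cases b)
    case True
    then show ?thesis
      using l by (intro exI[of _ "1 # l"]) (auto simp: is_index_def index_word_def)
  next
    case False
    then show ?thesis
      using l x by (intro exI[of _ "Suc x # l'"])
        (cases x, auto simp: is_index_def index_word_def)
  qed
qed

lemma replicate_False_True_inject: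
  "replicate a False @ True # v = replicate b False @ True # w \<Longrightarrow> a = b \<and> v = w"
proof (induction a arbitrary: b)
  case 0
  then show ?case by (cases b) auto
next
  case (Suc a)
  then show ?case by (cases b) auto
qed

text \<open>The first letter 1 determines the length of the first block. Positivity of the entries
  is assumed in place of \<open>is_index\<close> so that the induction may pass through the empty
  list.\<close>

lemma index_word_inject:
  assumes "\<forall>x\<in>set k. 1 \<le> x" "\<forall>x\<in>set l. 1 \<le> x" "index_word k = index_word l"
  shows "k = l"
  using assms
proof (induction k arbitrary: l)
  case Nil
  then show ?case by (cases l) (auto simp: index_word_def)
next
  case (Cons x k)
  then obtain y l' where l: "l = y # l'"
    by (cases l) (auto simp: index_word_def)
  have "x - 1 = y - 1" "index_word k = index_word l'"
    using Cons.prems(3) replicate_False_True_inject[of "x - 1" "index_word k" "y - 1" "index_word l'"]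
    by (simp_all add: l index_word_def)
  moreover have "1 \<le> x" "1 \<le> y"
    using Cons.prems by (simp_all add: l)
  ultimately show ?case
    using Cons.prems Cons.IH[of l'] by (simp add: l)
qed

text \<open>Every word ending in 1 comes from exactly one index, so the definite description in
  \<open>hoffman_dual\<close> denotes that index.\<close>

lemma
  shows is_index_hoffman_dual: "is_index (hoffman_dual k)"
    and butlast_index_word_hoffman_dual:
      "butlast (index_word (hoffman_dual k)) = map Not (butlast (index_word k))"
proof -
  let ?P = "\<lambda>l. is_index l \<and> index_word l = map Not (butlast (index_word k)) @ [True]"
  obtain l where "?P l"
    using index_word_surj by blast
  moreover have "l' = l" if "?P l'" for l'
    using that \<open>?P l\<close> index_word_inject[of l' l] by (simp add: is_index_def)
  ultimately have "?P (hoffman_dual k)"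
    unfolding hoffman_dual_def by (rule theI)
  then show "is_index (hoffman_dual k)"
    "butlast (index_word (hoffman_dual k)) = map Not (butlast (index_word k))"
    by simp_all
qed

section \<open>Duality of the limits at an odd number\<close>

lemma binom_transform_inner_star:
  "binom_transform (inner_star k u) n =
     inner_star (hoffman_dual k) 1 n - inner_star (hoffman_dual k) (1 - u) n"
  unfolding inner_star_def butlast_index_word_hoffman_dual binom_transform_word_op
    binom_transform_power_seq word_op_diff ..

text \<open>Exchanging the letters twice restores the word, and \<open>inner_star\<close> sees only
  the word.\<close>

lemma inner_star_hoffman_dual_dual:
  "inner_star (hoffman_dual (hoffman_dual k)) = inner_star k"
  by (simp add: fun_eq_iff inner_star_def butlast_index_word_hoffman_dual comp_def)

text \<open>The closed form of the sum over i of p^i times the polylogarithm sum for i leading ones.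
  The weight of a is the product of 1 / (1 - p / n) over a <= n < p.\<close>

definition star_limit :: "nat list \<Rightarrow> rat poly \<Rightarrow> nat \<Rightarrow> rat poly" where
  "star_limit k u p =
     (\<Sum>a=1..p - 1. smult ((-1) ^ (p - a) * of_nat ((p - 1) choose (a - 1))) (inner_star k u a))"

text \<open>For odd p the signs (-1)^(p - a) and (-1)^(a - 1) agree, so only the term n = p of the
  transform is missing; its weight is 1.\<close>

lemma star_limit_eq_transform:
  assumes "odd p"
  shows "star_limit k u p = binom_transform (inner_star k u) p - inner_star k u p"
proof -
  obtain m where p: "p = Suc m" "even m" using assms by (cases p) auto
  have "(-1) ^ (p - a) = ((-1) ^ (a - 1) :: rat)" if "a \<in> {1..p - 1}" for a
  proof -
    have "even (p - a) = even (a - 1)" using that p by auto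
    then show ?thesis by (cases "even (p - a)") simp_all
  qed
  then have "star_limit k u p =
     (\<Sum>a=1..p - 1. smult ((-1) ^ (a - 1) * of_nat ((p - 1) choose (a - 1))) (inner_star k u a))"
    unfolding star_limit_def by (intro sum.cong) simp_all
  also have "\<dots> = binom_transform (inner_star k u) p - inner_star k u p"
    using p by (simp add: binom_transform_def)
  finally show ?thesis .
qed

text \<open>Used for u = 1, where 1 - u = 0 and the subtracted sequence in the transform
  vanishes.\<close>

lemma inner_star_zero: "inner_star k 0 (Suc n) = 0"
proof -
  have "word_op w (power_seq 0) (Suc n) = 0" for w
    by (induction w arbitrary: n)
      (auto simp: power_seq_def letter_op_def intro!: sum.neutral simp: Suc_le_eq gr0_conv_Suc)
  then show ?thesis by (simp add: inner_star_def)
qed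

text \<open>Write s and s' for \<open>inner_star\<close> of k and of its dual, at p. The limit for u
  is s' 1 - s' (1 - u) - s u, and for u = 1 it is s' 1 - s 1. The left side is therefore s' 1 / 2 +
  s 1 / 2 - s' (1 - u) - s u, which is invariant under exchanging s with s' and u with 1 -
  u.\<close>

lemma star_limit_duality:
  assumes "odd p"
  shows "star_limit k u p - smult (1/2) (star_limit k 1 p) =
     star_limit (hoffman_dual k) (1 - u) p - smult (1/2) (star_limit (hoffman_dual k) 1 p)"
proof -
  have 0: "inner_star l 0 p = 0" for l
    using assms inner_star_zero by (cases p) auto
  \<comment> \<open>The arithmetic treats \<open>smult (1/2) a\<close> as an atom, so its relation
    to \<open>a\<close> is supplied explicitly.\<close>
  have half: "smult (1/2) a + smult (1/2) a = (a :: rat poly)" for a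
    by (simp flip: smult_add_left)
  show ?thesis
    using half[of "inner_star k 1 p"] half[of "inner_star (hoffman_dual k) 1 p"]
    by (simp add: star_limit_eq_transform[OF assms] binom_transform_inner_star
        inner_star_hoffman_dual_dual 0 smult_diff_right algebra_simps)
qed

section \<open>Rationals without \<open>p\<close> in the denominator\<close>

text \<open>For prime p, the localization of the integers at p. The fraction may be unreduced, which
  makes closure under sums and products immediate.\<close>

definition p_int :: "nat \<Rightarrow> rat set" where
  "p_int p = {of_int a / of_int b |a b. \<not> int p dvd b}"

definition p_int_poly :: "nat \<Rightarrow> rat poly set" where
  "p_int_poly p = {f. \<forall>j. poly.coeff f j \<in> p_int p}"

definition reduce_poly :: "nat \<Rightarrow> nat \<Rightarrow> rat poly \<Rightarrow> nat \<Rightarrow> int" where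
  "reduce_poly p n f = (\<lambda>j. rat_mod (int p ^ n) (poly.coeff f j))"

context
  fixes p :: nat
  assumes prime: "prime p"
begin

lemma p_intI: "\<not> int p dvd b \<Longrightarrow> q = of_int a / of_int b \<Longrightarrow> q \<in> p_int p"
  by (auto simp: p_int_def)

lemma not_dvd_nonzero: "\<not> int p dvd b \<Longrightarrow> b \<noteq> 0"
  by auto

lemma not_dvd_mult: "\<not> int p dvd a \<Longrightarrow> \<not> int p dvd b \<Longrightarrow> \<not> int p dvd a * b"
  using prime by (simp add: prime_dvd_mult_iff)

lemma coprime_power_of_not_dvd: "\<not> int p dvd b \<Longrightarrow> coprime b (int p ^ n)"
  using prime prime_imp_coprime[of "int p" b] by (simp add: coprime_commute)

lemma p_int_of_int [simp]: "of_int a \<in> p_int p"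
  using prime by (intro p_intI[of 1 _ a]) (auto simp: prime_gt_1_nat)

lemma p_int_of_nat [simp]: "of_nat a \<in> p_int p"
  using p_int_of_int[of "int a"] by simp

lemma p_int_0 [simp]: "0 \<in> p_int p" and p_int_1 [simp]: "1 \<in> p_int p"
  using p_int_of_nat[of 0] p_int_of_nat[of 1] by simp_all

lemma p_int_add: "x \<in> p_int p \<Longrightarrow> y \<in> p_int p \<Longrightarrow> x + y \<in> p_int p"
proof -
  assume "x \<in> p_int p" "y \<in> p_int p"
  then obtain a b c d where *: "x = of_int a / of_int b" "y = of_int c / of_int d"
    "\<not> int p dvd b" "\<not> int p dvd d"
    by (auto simp: p_int_def)
  then show "x + y \<in> p_int p"
    using not_dvd_nonzero
    by (intro p_intI[OF not_dvd_mult[of b d], of _ "a * d + c * b"])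
      (auto simp: field_simps)
qed

lemma p_int_mult: "x \<in> p_int p \<Longrightarrow> y \<in> p_int p \<Longrightarrow> x * y \<in> p_int p"
proof -
  assume "x \<in> p_int p" "y \<in> p_int p"
  then obtain a b c d where *: "x = of_int a / of_int b" "y = of_int c / of_int d"
    "\<not> int p dvd b" "\<not> int p dvd d"
    by (auto simp: p_int_def)
  then show "x * y \<in> p_int p"
    by (intro p_intI[OF not_dvd_mult[of b d], of _ "a * c"]) auto
qed

lemma p_int_uminus: "x \<in> p_int p \<Longrightarrow> - x \<in> p_int p"
  using p_int_mult[of "of_int (-1)" x] by (simp del: of_int_minus) simp

lemma p_int_diff: "x \<in> p_int p \<Longrightarrow> y \<in> p_int p \<Longrightarrow> x - y \<in> p_int p"
  using p_int_add[of x "- y"] p_int_uminus[of y] by simp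

lemma p_int_power: "x \<in> p_int p \<Longrightarrow> x ^ n \<in> p_int p"
  by (induction n) (auto intro: p_int_mult)

lemma p_int_sum: "(\<And>i. i \<in> A \<Longrightarrow> f i \<in> p_int p) \<Longrightarrow> sum f A \<in> p_int p"
  by (induction A rule: infinite_finite_induct) (auto intro: p_int_add)

lemma p_int_inverse: "\<not> int p dvd b \<Longrightarrow> 1 / of_int b \<in> p_int p"
  by (rule p_intI[of b _ 1]) auto

lemma p_int_inverse_of_nat: "0 < n \<Longrightarrow> n < p \<Longrightarrow> 1 / of_nat n \<in> p_int p"
  using p_int_inverse[of "int n"] nat_dvd_not_less[of n p] by simp

lemma p_int_poly_add: "f \<in> p_int_poly p \<Longrightarrow> g \<in> p_int_poly p \<Longrightarrow> f + g \<in> p_int_poly p"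
  by (auto simp: p_int_poly_def p_int_add)

lemma p_int_poly_diff: "f \<in> p_int_poly p \<Longrightarrow> g \<in> p_int_poly p \<Longrightarrow> f - g \<in> p_int_poly p"
  by (auto simp: p_int_poly_def p_int_diff)

lemma p_int_poly_mult: "f \<in> p_int_poly p \<Longrightarrow> g \<in> p_int_poly p \<Longrightarrow> f * g \<in> p_int_poly p"
  by (auto simp: p_int_poly_def coeff_mult intro!: p_int_mult p_int_sum)

lemma p_int_poly_smult: "c \<in> p_int p \<Longrightarrow> f \<in> p_int_poly p \<Longrightarrow> smult c f \<in> p_int_poly p"
  by (auto simp: p_int_poly_def intro!: p_int_mult)

lemma p_int_poly_pCons: "c \<in> p_int p \<Longrightarrow> f \<in> p_int_poly p \<Longrightarrow> pCons c f \<in> p_int_poly p"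
  by (auto simp: p_int_poly_def coeff_pCons split: nat.splits)

lemma p_int_poly_0 [simp]: "0 \<in> p_int_poly p"
  by (simp add: p_int_poly_def)

lemma p_int_poly_1 [simp]: "1 \<in> p_int_poly p"
  by (simp add: one_pCons p_int_poly_pCons)

lemma p_int_poly_of_nat [simp]: "of_nat n \<in> p_int_poly p"
  by (simp add: of_nat_poly p_int_poly_pCons)

lemma p_int_poly_power: "f \<in> p_int_poly p \<Longrightarrow> f ^ n \<in> p_int_poly p"
  by (induction n) (auto intro: p_int_poly_mult)

lemma p_int_poly_sum: "(\<And>i. i \<in> A \<Longrightarrow> f i \<in> p_int_poly p) \<Longrightarrow> sum f A \<in> p_int_poly p"
  by (induction A rule: infinite_finite_induct) (auto intro: p_int_poly_add)

text \<open>\<open>rat_mod\<close> is computed from the reduced fraction; any decomposition of q as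
  an integer r plus p^n times a p-integral number determines it as well. Later arguments thus avoid
  numerators and denominators.\<close>

lemma rat_mod_eq:
  assumes "z \<in> p_int p" "q = of_int r + of_nat p ^ n * z"
  shows "rat_mod (int p ^ n) q = r mod int p ^ n"
proof -
  let ?m = "int p ^ n"
  obtain a b where z: "z = of_int a / of_int b" "\<not> int p dvd b"
    using assms(1) by (auto simp: p_int_def)
  obtain c d where cd: "quotient_of q = (c, d)"
    by fastforce
  then have q: "q = of_int c / of_int d" "coprime c d" "0 < d"
    using quotient_of_div quotient_of_coprime quotient_of_denom_pos by blast+
  have "(of_int (c * b) :: rat) = of_int ((r * b + ?m * a) * d)"
    using q(1,3) assms(2) z not_dvd_nonzero[OF z(2)] by (simp add: field_simps)
  then have eq: "c * b = (r * b + ?m * a) * d"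
    by (simp only: of_int_eq_iff)
  \<comment> \<open>If p divided the reduced denominator d, it would divide c * b, hence c, against
    coprimality of c and d.\<close>
  have "\<not> int p dvd d"
  proof
    assume d: "int p dvd d"
    then have "int p dvd c * b"
      unfolding eq by simp
    then have "int p dvd c"
      using z(2) prime by (simp add: prime_dvd_mult_iff)
    with d q(2) show False
      using prime coprime_common_divisor[of c d "int p"] by simp
  qed
  then have inv: "[d * modular_inverse ?m d = 1] (mod ?m)"
    by (intro cong_modular_inverse1 coprime_power_of_not_dvd)
  \<comment> \<open>The cross-multiplied equation modulo p^n; b is a unit there and is cancelled
    next.\<close>
  have "[b * c = b * (r * d)] (mod ?m)"
  proof -
    have "b * c - b * (r * d) = ?m * (a * d)"
      using eq by (simp add: algebra_simps)
    then show ?thesis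
      by (simp add: cong_iff_dvd_diff)
  qed
  then have "[c = r * d] (mod ?m)"
    using coprime_power_of_not_dvd[OF z(2)] by (simp add: cong_mult_lcancel)
  then have "[c * modular_inverse ?m d = r * d * modular_inverse ?m d] (mod ?m)"
    by (rule cong_scalar_right)
  also have "[r * d * modular_inverse ?m d = r * 1] (mod ?m)"
    unfolding mult.assoc using inv by (rule cong_scalar_left)
  finally show ?thesis
    by (simp add: rat_mod_def cd cong_def)
qed

text \<open>The converse of \<open>rat_mod_eq\<close>: a decomposition exists, and its integer part
  may be taken to be the residue itself.\<close>

lemma rat_mod_decomp:
  assumes "q \<in> p_int p"
  obtains r z where "z \<in> p_int p" "q = of_int r + of_nat p ^ n * z" "rat_mod (int p ^ n) q = r"
proof -
  let ?m = "int p ^ n"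
  obtain a b where q: "q = of_int a / of_int b" "\<not> int p dvd b"
    using assms by (auto simp: p_int_def)
  define e where "e = modular_inverse ?m b"
  have "[b * e = 1] (mod ?m)"
    unfolding e_def by (intro cong_modular_inverse1 coprime_power_of_not_dvd q)
  then obtain f where f: "1 = b * e + ?m * f"
    by (auto simp: cong_iff_lin)
  \<comment> \<open>From 1 = b * e + p^n * f follows a / b = a * e + p^n * (a * f / b).\<close>
  define z where "z = of_int (a * f) / (of_int b :: rat)"
  have z: "z \<in> p_int p"
    unfolding z_def by (rule p_intI[OF q(2) refl])
  have "(of_int 1 :: rat) = of_int (b * e + ?m * f)"
    using f by simp
  then have "of_int a = (of_int a * (of_int b * of_int e + of_nat p ^ n * of_int f) :: rat)"
    by simp
  then have eq: "q = of_int (a * e) + of_nat p ^ n * z"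
    using not_dvd_nonzero[OF q(2)] by (simp add: z_def q(1) field_simps)
  \<comment> \<open>The integer part is replaced by its residue, and the quotient goes into the
    multiple of p^n.\<close>
  also have "of_int (a * e) = (of_int (a * e mod ?m) + of_nat p ^ n * of_int (a * e div ?m) :: rat)"
  proof -
    have "of_int (a * e) = (of_int (a * e mod ?m + ?m * (a * e div ?m)) :: rat)"
      by (simp only: mod_mult_div_eq)
    then show ?thesis by (simp only: of_int_add of_int_mult of_int_power of_int_of_nat_eq)
  qed
  finally have "q = of_int (a * e mod ?m) + of_nat p ^ n * (of_int (a * e div ?m) + z)"
    by (simp only: distrib_left add.assoc)
  moreover have "rat_mod ?m q = a * e mod ?m"
    by (rule rat_mod_eq[OF z eq])
  ultimately show thesis
    by (rule that[rotated]) (intro p_int_add z p_int_of_int)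
qed

lemma rat_mod_range: "q \<in> p_int p \<Longrightarrow> rat_mod (int p ^ n) q \<in> {0..int p ^ n - 1}"
  using prime by (auto simp: rat_mod_def prime_gt_0_nat split: prod.splits)

lemma rat_mod_of_int: "rat_mod (int p ^ n) (of_int a) = a mod int p ^ n"
  by (rule rat_mod_eq[of 0]) simp_all

text \<open>Decompositions of x and y add up to one of x + y, from which \<open>rat_mod_eq\<close>
  reads off the residue. The product is treated in the same way.\<close>

lemma rat_mod_add:
  assumes "x \<in> p_int p" "y \<in> p_int p"
  shows "rat_mod (int p ^ n) (x + y) =
    (rat_mod (int p ^ n) x + rat_mod (int p ^ n) y) mod int p ^ n"
proof -
  obtain r z where z: "z \<in> p_int p" "x = of_int r + of_nat p ^ n * z" "rat_mod (int p ^ n) x = r"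
    using rat_mod_decomp[OF assms(1)] .
  obtain s w where w: "w \<in> p_int p" "y = of_int s + of_nat p ^ n * w" "rat_mod (int p ^ n) y = s"
    using rat_mod_decomp[OF assms(2)] .
  have "x + y = of_int (r + s) + of_nat p ^ n * (z + w)"
    unfolding z(2) w(2) by (simp add: algebra_simps)
  then show ?thesis
    unfolding z(3) w(3) by (rule rat_mod_eq[rotated]) (intro p_int_add z w)
qed

lemma rat_mod_mult:
  assumes "x \<in> p_int p" "y \<in> p_int p"
  shows "rat_mod (int p ^ n) (x * y) =
    (rat_mod (int p ^ n) x * rat_mod (int p ^ n) y) mod int p ^ n"
proof -
  obtain r z where z: "z \<in> p_int p" "x = of_int r + of_nat p ^ n * z" "rat_mod (int p ^ n) x = r"
    using rat_mod_decomp[OF assms(1)] .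
  obtain s w where w: "w \<in> p_int p" "y = of_int s + of_nat p ^ n * w" "rat_mod (int p ^ n) y = s"
    using rat_mod_decomp[OF assms(2)] .
  have "x * y = of_int (r * s) + of_nat p ^ n * (of_int r * w + z * y)"
    unfolding z(2) w(2) by (simp add: algebra_simps)
  then show ?thesis
    unfolding z(3) w(3)
    by (rule rat_mod_eq[rotated]) (intro p_int_add p_int_mult p_int_of_int z w assms)
qed

lemma rat_mod_sum:
  assumes "finite A" "\<And>i. i \<in> A \<Longrightarrow> f i \<in> p_int p"
  shows "rat_mod (int p ^ n) (sum f A) = (\<Sum>i\<in>A. rat_mod (int p ^ n) (f i)) mod int p ^ n"
  using assms
proof (induction A rule: finite_induct)
  case empty
  then show ?case using rat_mod_of_int[of n 0] by simp
next
  case (insert i A)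
  then show ?case
    by (simp add: rat_mod_add p_int_sum mod_add_right_eq)
qed

lemma rat_mod_mod:
  assumes "x \<in> p_int p"
  shows "rat_mod (int p ^ Suc n) x mod int p ^ n = rat_mod (int p ^ n) x"
proof -
  obtain r z where z: "z \<in> p_int p" "x = of_int r + of_nat p ^ Suc n * z"
      "rat_mod (int p ^ Suc n) x = r"
    using rat_mod_decomp[OF assms] .
  have "x = of_int r + of_nat p ^ n * (of_nat p * z)"
    unfolding z(2) by simp
  then have "rat_mod (int p ^ n) x = r mod int p ^ n"
    by (rule rat_mod_eq[rotated]) (intro p_int_mult z p_int_of_nat)
  then show ?thesis
    unfolding z(3) ..
qed

lemma rat_mod_cong:
  assumes "x \<in> p_int p" "z \<in> p_int p" "y = x + of_nat p ^ n * z"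
  shows "rat_mod (int p ^ n) y = rat_mod (int p ^ n) x"
proof -
  obtain r w where w: "w \<in> p_int p" "x = of_int r + of_nat p ^ n * w" "rat_mod (int p ^ n) x = r"
    using rat_mod_decomp[OF assms(1)] .
  have "y = of_int r + of_nat p ^ n * (w + z)"
    unfolding assms(3) w(2) by (simp add: algebra_simps)
  then have "rat_mod (int p ^ n) y = r mod int p ^ n"
    by (rule rat_mod_eq[rotated]) (intro p_int_add w assms)
  then show ?thesis
    using rat_mod_range[OF assms(1), of n] w(3) by simp
qed

end

section \<open>Polynomial rings modulo prime powers\<close>

lemma Zt_hat_of_poly_eq: "1 \<le> n \<Longrightarrow> Zt_hat_of_poly p f n = reduce_poly p n f"
  by (simp add: Zt_hat_of_poly_def reduce_poly_def)

lemma residues_prime_power: "prime p \<Longrightarrow> 1 \<le> n \<Longrightarrow> residues (int p ^ n)"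
  unfolding residues_def using prime_gt_1_nat[of p] by (intro one_less_power) auto

context residues
begin

text \<open>Coefficients of products in \<open>UP\<close> are sums inside the residue ring; this
  turns them into integer sums followed by one reduction.\<close>

lemma finsum_residue_ring:
  assumes "finite A" "\<And>i. i \<in> A \<Longrightarrow> f i \<in> carrier R"
  shows "finsum R f A = sum f A mod m"
  using assms
proof (induction A rule: finite_induct)
  case empty
  then show ?case by (simp add: res_zero_eq)
next
  case (insert i A)
  then have "finsum R f (insert i A) = f i \<oplus> finsum R f A"
    by (intro finsum_insert) auto
  with insert show ?case
    by (simp add: res_add_eq mod_add_right_eq)
qed

end

lemma cring_Zpn_poly: "prime p \<Longrightarrow> 1 \<le> n \<Longrightarrow> cring (Zpn_poly n p)"
proof -
  assume "prime p" "1 \<le> n"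
  then interpret residues "int p ^ n" "residue_ring (int p ^ n)"
    by (intro residues_prime_power) auto
  interpret UP_cring "residue_ring (int p ^ n)" "Zpn_poly n p"
    by unfold_locales (simp_all add: Zpn_poly_def)
  show ?thesis by (rule UP_cring)
qed

context
  fixes p n :: nat
  assumes p: "prime p" and n: "1 \<le> n"
begin

interpretation residues "int p ^ n" "residue_ring (int p ^ n)"
  using p n by (intro residues_prime_power) auto

lemma carrier_Zpn_poly:
  "carrier (Zpn_poly n p) = {f. (\<forall>j. f j \<in> {0..int p ^ n - 1}) \<and> (\<exists>N. \<forall>j>N. f j = 0)}"
  by (auto simp: Zpn_poly_def UP_def up_def res_carrier_eq res_zero_eq bound_def)

lemma one_Zpn_poly: "\<one>\<^bsub>Zpn_poly n p\<^esub> = (\<lambda>i. if i = 0 then 1 else 0)"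
  by (auto simp: Zpn_poly_def UP_def res_zero_eq res_one_eq)

lemma add_Zpn_poly:
  "f \<in> carrier (Zpn_poly n p) \<Longrightarrow> g \<in> carrier (Zpn_poly n p) \<Longrightarrow>
     f \<oplus>\<^bsub>Zpn_poly n p\<^esub> g = (\<lambda>j. (f j + g j) mod int p ^ n)"
  by (simp add: Zpn_poly_def UP_def res_add_eq)

lemma mult_Zpn_poly:
  assumes "f \<in> carrier (Zpn_poly n p)" "g \<in> carrier (Zpn_poly n p)"
  shows "f \<otimes>\<^bsub>Zpn_poly n p\<^esub> g = (\<lambda>j. (\<Sum>i\<le>j. f i * g (j - i)) mod int p ^ n)"
proof
  fix j
  have fg: "f \<in> up (residue_ring (int p ^ n))" "g \<in> up (residue_ring (int p ^ n))"
    using assms by (simp_all add: Zpn_poly_def UP_def)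
  then have "(f \<otimes>\<^bsub>Zpn_poly n p\<^esub> g) j =
      (\<Oplus>\<^bsub>residue_ring (int p ^ n)\<^esub>i\<in>{..j}. f i \<otimes>\<^bsub>residue_ring (int p ^ n)\<^esub> g (j - i))"
    by (simp add: Zpn_poly_def UP_def)
  also have "\<dots> = (\<Sum>i\<le>j. f i \<otimes>\<^bsub>residue_ring (int p ^ n)\<^esub> g (j - i)) mod int p ^ n"
    using fg by (intro finsum_residue_ring) auto
  also have "\<dots> = (\<Sum>i\<le>j. f i * g (j - i)) mod int p ^ n"
    by (simp add: res_mult_eq mod_sum_eq)
  finally show "(f \<otimes>\<^bsub>Zpn_poly n p\<^esub> g) j = (\<Sum>i\<le>j. f i * g (j - i)) mod int p ^ n" .
qed

lemma reduce_poly_closed: "f \<in> p_int_poly p \<Longrightarrow> reduce_poly p n f \<in> carrier (Zpn_poly n p)"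
proof -
  assume "f \<in> p_int_poly p"
  moreover have "reduce_poly p n f j = 0" if "j > Polynomial.degree f" for j
    using that rat_mod_of_int[OF p, of n 0] by (simp add: reduce_poly_def coeff_eq_0)
  ultimately show ?thesis
    using rat_mod_range[OF p] unfolding carrier_Zpn_poly
    by (auto simp: reduce_poly_def p_int_poly_def simp del: atLeastAtMost_iff)
qed

lemma reduce_poly_one: "reduce_poly p n 1 = \<one>\<^bsub>Zpn_poly n p\<^esub>"
  using rat_mod_of_int[OF p, of n 0] rat_mod_of_int[OF p, of n 1] m_gt_one
  by (auto simp: one_Zpn_poly reduce_poly_def one_pCons coeff_pCons fun_eq_iff split: nat.splits)

lemma reduce_poly_add:
  assumes "f \<in> p_int_poly p" "g \<in> p_int_poly p"
  shows "reduce_poly p n (f + g) = reduce_poly p n f \<oplus>\<^bsub>Zpn_poly n p\<^esub> reduce_poly p n g"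
  unfolding add_Zpn_poly[OF assms[THEN reduce_poly_closed]]
  using assms by (simp add: reduce_poly_def rat_mod_add[OF p] p_int_poly_def)

lemma reduce_poly_mult:
  assumes "f \<in> p_int_poly p" "g \<in> p_int_poly p"
  shows "reduce_poly p n (f * g) = reduce_poly p n f \<otimes>\<^bsub>Zpn_poly n p\<^esub> reduce_poly p n g"
  unfolding mult_Zpn_poly[OF assms[THEN reduce_poly_closed]]
  using assms
  by (simp add: reduce_poly_def rat_mod_sum[OF p] rat_mod_mult[OF p] p_int_mult[OF p]
      p_int_poly_def coeff_mult mod_sum_eq)

text \<open>The form in which truncation errors, multiples of p^n, disappear at level n.\<close>

lemma reduce_poly_cong:
  assumes "g \<in> p_int_poly p" "h \<in> p_int_poly p" "f = g + smult (of_nat p ^ n) h"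
  shows "reduce_poly p n f = reduce_poly p n g"
  using assms rat_mod_cong[OF p] by (simp add: reduce_poly_def p_int_poly_def)

lemma Zpn_reduce_reduce_poly:
  "f \<in> p_int_poly p \<Longrightarrow> Zpn_reduce n p (reduce_poly p (Suc n) f) = reduce_poly p n f"
  unfolding Zpn_reduce_def reduce_poly_def p_int_poly_def
  using rat_mod_mod[OF p] by simp


end

lemma Zpn_reduce_closed:
  assumes "prime p" "1 \<le> n" "f \<in> carrier (Zpn_poly (Suc n) p)"
  shows "Zpn_reduce n p f \<in> carrier (Zpn_poly n p)"
proof -
  obtain N where "\<forall>j>N. f j = 0"
    using assms(3) carrier_Zpn_poly[OF assms(1), of "Suc n"] by auto
  then have "\<forall>j>N. f j mod int p ^ n = 0"
    by simp
  then show ?thesis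
    using assms(1) unfolding carrier_Zpn_poly[OF assms(1,2)]
    by (auto simp: Zpn_reduce_def prime_gt_0_nat)
qed

lemma Zpn_reduce_hom:
  assumes p: "prime p" and n: "1 \<le> n"
  shows "Zpn_reduce n p \<in> ring_hom (Zpn_poly (Suc n) p) (Zpn_poly n p)"
proof (rule ring_hom_memI)
  have n': "1 \<le> Suc n" by simp
  have mm: "a mod int p ^ Suc n mod int p ^ n = a mod int p ^ n" for a
    by (rule mod_mod_cancel) simp
  show "Zpn_reduce n p \<one>\<^bsub>Zpn_poly (Suc n) p\<^esub> = \<one>\<^bsub>Zpn_poly n p\<^esub>"
    using residues.m_gt_one[OF residues_prime_power[OF p n]]
    by (auto simp: one_Zpn_poly[OF p n] one_Zpn_poly[OF p n'] Zpn_reduce_def)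
  fix f assume f: "f \<in> carrier (Zpn_poly (Suc n) p)"
  then show f': "Zpn_reduce n p f \<in> carrier (Zpn_poly n p)"
    by (rule Zpn_reduce_closed[OF p n])
  fix g assume g: "g \<in> carrier (Zpn_poly (Suc n) p)"
  then have g': "Zpn_reduce n p g \<in> carrier (Zpn_poly n p)"
    by (rule Zpn_reduce_closed[OF p n])
  show "Zpn_reduce n p (f \<oplus>\<^bsub>Zpn_poly (Suc n) p\<^esub> g) =
      Zpn_reduce n p f \<oplus>\<^bsub>Zpn_poly n p\<^esub> Zpn_reduce n p g"
    unfolding add_Zpn_poly[OF p n f' g'] add_Zpn_poly[OF p n' f g]
    unfolding Zpn_reduce_def mm by (simp add: mod_add_eq)
  show "Zpn_reduce n p (f \<otimes>\<^bsub>Zpn_poly (Suc n) p\<^esub> g) =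
      Zpn_reduce n p f \<otimes>\<^bsub>Zpn_poly n p\<^esub> Zpn_reduce n p g"
    unfolding mult_Zpn_poly[OF p n f' g'] mult_Zpn_poly[OF p n' f g]
    unfolding Zpn_reduce_def mm 
    \<comment> \<open>Reducing every summand on both sides makes the comparison termwise.\<close>
    by (subst (1 2) mod_sum_eq[symmetric]) (simp add: mod_mult_eq)
qed

section \<open>The ring structure of \<open>\<A>\<close>-hat\<close>

lemma product_ring_simps [simp]:
  "carrier (product_ring I R) = (\<Pi>\<^sub>E i\<in>I. carrier (R i))"
  "x \<otimes>\<^bsub>product_ring I R\<^esub> y = (\<lambda>i\<in>I. x i \<otimes>\<^bsub>R i\<^esub> y i)"
  "x \<oplus>\<^bsub>product_ring I R\<^esub> y = (\<lambda>i\<in>I. x i \<oplus>\<^bsub>R i\<^esub> y i)"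
  "\<one>\<^bsub>product_ring I R\<^esub> = (\<lambda>i\<in>I. \<one>\<^bsub>R i\<^esub>)"
  "\<zero>\<^bsub>product_ring I R\<^esub> = (\<lambda>i\<in>I. \<zero>\<^bsub>R i\<^esub>)"
  by (simp_all add: product_ring_def)

context
  fixes I :: "'i set" and R :: "'i \<Rightarrow> ('a, 'b) ring_scheme"
  assumes cring: "\<And>i. i \<in> I \<Longrightarrow> cring (R i)"
begin

lemma ring_factor: "i \<in> I \<Longrightarrow> ring (R i)"
  using cring cring.axioms(1) by blast

lemma ring_semiring: "i \<in> I \<Longrightarrow> semiring (R i)"
proof -
  assume "i \<in> I"
  then interpret ring "R i" by (rule ring_factor)
  show "semiring (R i)" by (rule semiring_axioms)
qed

lemma product_ring_mem: "x \<in> (\<Pi>\<^sub>E i\<in>I. carrier (R i)) \<Longrightarrow> i \<in> I \<Longrightarrow> x i \<in> carrier (R i)"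
  by (rule PiE_mem)

lemma product_ring_eqI:
  assumes "x \<in> carrier (product_ring I R)" "y \<in> carrier (product_ring I R)" "\<And>i. i \<in> I \<Longrightarrow> x i = y i"
  shows "x = y"
  using assms by (auto intro: PiE_ext)

lemma product_ring_cring: "cring (product_ring I R)"
proof -
  have unary: "\<zero>\<^bsub>R i\<^esub> \<oplus>\<^bsub>R i\<^esub> x = x"
      "\<one>\<^bsub>R i\<^esub> \<otimes>\<^bsub>R i\<^esub> x = x"
      "\<ominus>\<^bsub>R i\<^esub> x \<oplus>\<^bsub>R i\<^esub> x = \<zero>\<^bsub>R i\<^esub>"
      "\<ominus>\<^bsub>R i\<^esub> x \<in> carrier (R i)"
    if "i \<in> I" "x \<in> carrier (R i)" for i x
  proof -
    interpret cring "R i" by (rule cring) fact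
    show "\<zero>\<^bsub>R i\<^esub> \<oplus>\<^bsub>R i\<^esub> x = x"
      "\<one>\<^bsub>R i\<^esub> \<otimes>\<^bsub>R i\<^esub> x = x"
      "\<ominus>\<^bsub>R i\<^esub> x \<oplus>\<^bsub>R i\<^esub> x = \<zero>\<^bsub>R i\<^esub>"
      "\<ominus>\<^bsub>R i\<^esub> x \<in> carrier (R i)"
      using that by - (rule l_zero l_one l_neg a_inv_closed; assumption)+
  qed
  have binary: "x \<oplus>\<^bsub>R i\<^esub> y = y \<oplus>\<^bsub>R i\<^esub> x"
      "x \<otimes>\<^bsub>R i\<^esub> y = y \<otimes>\<^bsub>R i\<^esub> x"
      "x \<oplus>\<^bsub>R i\<^esub> y \<in> carrier (R i)"
      "x \<otimes>\<^bsub>R i\<^esub> y \<in> carrier (R i)"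
    if "i \<in> I" "x \<in> carrier (R i)" "y \<in> carrier (R i)" for i x y
  proof -
    interpret cring "R i" by (rule cring) fact
    show "x \<oplus>\<^bsub>R i\<^esub> y = y \<oplus>\<^bsub>R i\<^esub> x"
      "x \<otimes>\<^bsub>R i\<^esub> y = y \<otimes>\<^bsub>R i\<^esub> x"
      "x \<oplus>\<^bsub>R i\<^esub> y \<in> carrier (R i)"
      "x \<otimes>\<^bsub>R i\<^esub> y \<in> carrier (R i)"
      using that by - (rule a_comm m_comm a_closed m_closed; assumption)+
  qed
  have ternary: "(x \<oplus>\<^bsub>R i\<^esub> y) \<oplus>\<^bsub>R i\<^esub> z = x \<oplus>\<^bsub>R i\<^esub> (y \<oplus>\<^bsub>R i\<^esub> z)"
      "(x \<otimes>\<^bsub>R i\<^esub> y) \<otimes>\<^bsub>R i\<^esub> z = x \<otimes>\<^bsub>R i\<^esub> (y \<otimes>\<^bsub>R i\<^esub> z)"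
      "(x \<oplus>\<^bsub>R i\<^esub> y) \<otimes>\<^bsub>R i\<^esub> z = (x \<otimes>\<^bsub>R i\<^esub> z) \<oplus>\<^bsub>R i\<^esub> (y \<otimes>\<^bsub>R i\<^esub> z)"
    if "i \<in> I" "x \<in> carrier (R i)" "y \<in> carrier (R i)" "z \<in> carrier (R i)" for i x y z
  proof -
    interpret cring "R i" by (rule cring) fact
    show "(x \<oplus>\<^bsub>R i\<^esub> y) \<oplus>\<^bsub>R i\<^esub> z = x \<oplus>\<^bsub>R i\<^esub> (y \<oplus>\<^bsub>R i\<^esub> z)"
      "(x \<otimes>\<^bsub>R i\<^esub> y) \<otimes>\<^bsub>R i\<^esub> z = x \<otimes>\<^bsub>R i\<^esub> (y \<otimes>\<^bsub>R i\<^esub> z)"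
      "(x \<oplus>\<^bsub>R i\<^esub> y) \<otimes>\<^bsub>R i\<^esub> z = (x \<otimes>\<^bsub>R i\<^esub> z) \<oplus>\<^bsub>R i\<^esub> (y \<otimes>\<^bsub>R i\<^esub> z)"
      using that by - (rule a_assoc m_assoc l_distr; assumption)+
  qed
  show ?thesis
  proof (intro cringI abelian_groupI comm_monoidI)
    show "\<zero>\<^bsub>product_ring I R\<^esub> \<in> carrier (product_ring I R)" "\<one>\<^bsub>product_ring I R\<^esub> \<in> carrier (product_ring I R)"
      using ring_factor by (auto simp: ring.ring_simprules)
    fix x assume x: "x \<in> carrier (product_ring I R)"
    then have mx: "x i \<in> carrier (R i)" if "i \<in> I" for i
      using that by (auto intro: product_ring_mem)
    have x': "restrict x I = x"
      using x by (intro extensional_restrict) (auto simp: PiE_def)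
    \<comment> \<open>Elements of the product are extensional, so \<open>x\<close> equals every
      restricted function that agrees with it on \<open>I\<close>.\<close>
    have restrict_eq_x: "restrict f I = x" if "\<And>i. i \<in> I \<Longrightarrow> f i = x i" for f
      using restrict_ext[of I f x, OF that] x' by simp
    show "\<zero>\<^bsub>product_ring I R\<^esub> \<oplus>\<^bsub>product_ring I R\<^esub> x = x" "\<one>\<^bsub>product_ring I R\<^esub> \<otimes>\<^bsub>product_ring I R\<^esub> x = x"
      unfolding product_ring_simps by (rule restrict_eq_x, simp add: unary mx)+
    have "(\<lambda>i\<in>I. \<ominus>\<^bsub>R i\<^esub> x i) \<oplus>\<^bsub>product_ring I R\<^esub> x = \<zero>\<^bsub>product_ring I R\<^esub>"
      unfolding product_ring_simps by (rule restrict_ext) (simp add: unary mx)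
    moreover have "(\<lambda>i\<in>I. \<ominus>\<^bsub>R i\<^esub> x i) \<in> carrier (product_ring I R)"
      using mx unary(4) by simp
    ultimately show "\<exists>y\<in>carrier (product_ring I R). y \<oplus>\<^bsub>product_ring I R\<^esub> x = \<zero>\<^bsub>product_ring I R\<^esub>"
      by blast
    fix y assume "y \<in> carrier (product_ring I R)"
    then have my: "y i \<in> carrier (R i)" if "i \<in> I" for i
      using that by (auto intro: product_ring_mem)
    show "x \<oplus>\<^bsub>product_ring I R\<^esub> y \<in> carrier (product_ring I R)" "x \<otimes>\<^bsub>product_ring I R\<^esub> y \<in> carrier (product_ring I R)"
      using mx my binary(3,4) by simp_all
    show "x \<oplus>\<^bsub>product_ring I R\<^esub> y = y \<oplus>\<^bsub>product_ring I R\<^esub> x" "x \<otimes>\<^bsub>product_ring I R\<^esub> y = y \<otimes>\<^bsub>product_ring I R\<^esub> x"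
      unfolding product_ring_simps by (rule restrict_ext, rule binary; simp add: mx my)+
    fix z assume "z \<in> carrier (product_ring I R)"
    then have mz: "z i \<in> carrier (R i)" if "i \<in> I" for i
      using that by (auto intro: product_ring_mem)
    show "(x \<oplus>\<^bsub>product_ring I R\<^esub> y) \<oplus>\<^bsub>product_ring I R\<^esub> z = x \<oplus>\<^bsub>product_ring I R\<^esub> (y \<oplus>\<^bsub>product_ring I R\<^esub> z)" "(x \<otimes>\<^bsub>product_ring I R\<^esub> y) \<otimes>\<^bsub>product_ring I R\<^esub> z = x \<otimes>\<^bsub>product_ring I R\<^esub> (y \<otimes>\<^bsub>product_ring I R\<^esub> z)"
      "(x \<oplus>\<^bsub>product_ring I R\<^esub> y) \<otimes>\<^bsub>product_ring I R\<^esub> z = (x \<otimes>\<^bsub>product_ring I R\<^esub> z) \<oplus>\<^bsub>product_ring I R\<^esub> (y \<otimes>\<^bsub>product_ring I R\<^esub> z)"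
      unfolding product_ring_simps by (rule restrict_ext, simp add: ternary mx my mz)+
  qed
qed

lemma product_ring_a_inv:
  assumes "x \<in> carrier (product_ring I R)"
  shows "\<ominus>\<^bsub>product_ring I R\<^esub> x = (\<lambda>i\<in>I. \<ominus>\<^bsub>R i\<^esub> x i)"
proof -
  interpret cring "product_ring I R" by (rule product_ring_cring)
  note simps = cring.cring_simprules[OF cring]
  have "(\<lambda>i\<in>I. \<ominus>\<^bsub>R i\<^esub> x i) \<in> carrier (product_ring I R)"
    using assms by (auto simp: product_ring_mem simps)
  moreover from this have "(\<lambda>i\<in>I. \<ominus>\<^bsub>R i\<^esub> x i) \<oplus>\<^bsub>product_ring I R\<^esub> x = \<zero>\<^bsub>product_ring I R\<^esub>"
    using assms by (intro product_ring_eqI a_closed zero_closed) (simp_all add: product_ring_mem simps)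
  ultimately show ?thesis
    using assms by (intro minus_equality)
qed

lemma product_ring_minus:
  assumes "x \<in> carrier (product_ring I R)" "y \<in> carrier (product_ring I R)"
  shows "x \<ominus>\<^bsub>product_ring I R\<^esub> y = (\<lambda>i\<in>I. x i \<ominus>\<^bsub>R i\<^esub> y i)"
  unfolding a_minus_def product_ring_a_inv[OF assms(2)] by (auto simp: restrict_def)

text \<open>The support of a sum lies in the union of the supports; negation and multiplication do
  not enlarge a support.\<close>

lemma direct_sum_ideal: "ideal (direct_sum I R) (product_ring I R)"
proof -
  interpret P: cring "product_ring I R" by (rule product_ring_cring)
  have supp_add: "finite {i \<in> I. x i \<oplus>\<^bsub>R i\<^esub> y i \<noteq> \<zero>\<^bsub>R i\<^esub>}"
    if "finite {i \<in> I. x i \<noteq> \<zero>\<^bsub>R i\<^esub>}" "finite {i \<in> I. y i \<noteq> \<zero>\<^bsub>R i\<^esub>}" for x y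
    by (rule finite_subset[OF _ finite_UnI[OF that]])
      (use ring_factor in \<open>auto simp: ring.ring_simprules\<close>)
  have supp_neg: "finite {i \<in> I. \<ominus>\<^bsub>R i\<^esub> x i \<noteq> \<zero>\<^bsub>R i\<^esub>}"
    if "finite {i \<in> I. x i \<noteq> \<zero>\<^bsub>R i\<^esub>}" for x
    by (rule finite_subset[OF _ that])
      (use ring_factor in \<open>auto simp: ring.minus_zero\<close>)
  have supp_mult: "finite {i \<in> I. y i \<otimes>\<^bsub>R i\<^esub> x i \<noteq> \<zero>\<^bsub>R i\<^esub>}"
    if "finite {i \<in> I. x i \<noteq> \<zero>\<^bsub>R i\<^esub>}" "y \<in> carrier (product_ring I R)" for x y
    by (rule finite_subset[OF _ that(1)])
      (use ring_factor that(2) in \<open>auto simp: product_ring_mem semiring.r_null[OF ring_semiring]\<close>)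
  have closed: "\<ominus>\<^bsub>product_ring I R\<^esub> x \<in> direct_sum I R" if "x \<in> direct_sum I R" for x
  proof -
    have x: "x \<in> carrier (product_ring I R)" "finite {i \<in> I. x i \<noteq> \<zero>\<^bsub>R i\<^esub>}"
      using that by (simp_all add: direct_sum_def)
    have "{i \<in> I. (\<ominus>\<^bsub>product_ring I R\<^esub> x) i \<noteq> \<zero>\<^bsub>R i\<^esub>} = {i \<in> I. \<ominus>\<^bsub>R i\<^esub> x i \<noteq> \<zero>\<^bsub>R i\<^esub>}"
      using product_ring_a_inv[OF x(1)] by auto
    then show ?thesis
      using P.a_inv_closed[OF x(1)] supp_neg[OF x(2)] by (simp add: direct_sum_def)
  qed
  have mult: "y \<otimes>\<^bsub>product_ring I R\<^esub> x \<in> direct_sum I R"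
    if "x \<in> direct_sum I R" "y \<in> carrier (product_ring I R)" for x y
  proof -
    have x: "x \<in> carrier (product_ring I R)" "finite {i \<in> I. x i \<noteq> \<zero>\<^bsub>R i\<^esub>}"
      using that by (simp_all add: direct_sum_def)
    have "{i \<in> I. (y \<otimes>\<^bsub>product_ring I R\<^esub> x) i \<noteq> \<zero>\<^bsub>R i\<^esub>} =
        {i \<in> I. y i \<otimes>\<^bsub>R i\<^esub> x i \<noteq> \<zero>\<^bsub>R i\<^esub>}"
      by auto
    then show ?thesis
      unfolding direct_sum_def
      using P.m_closed[OF that(2) x(1)] supp_mult[OF x(2) that(2)] by (simp del: product_ring_simps)
  qed
  show ?thesis
  proof (rule idealI)
    show "subgroup (direct_sum I R) (add_monoid (product_ring I R))"
    proof (rule P.add.subgroupI)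
      show "direct_sum I R \<subseteq> carrier (product_ring I R)"
        by (auto simp only: direct_sum_def)
      have "\<zero>\<^bsub>product_ring I R\<^esub> \<in> direct_sum I R"
        using P.zero_closed by (simp add: direct_sum_def)
      then show "direct_sum I R \<noteq> {}" by blast
      show "\<ominus>\<^bsub>product_ring I R\<^esub> x \<in> direct_sum I R" if "x \<in> direct_sum I R" for x
        by (rule closed[OF that])
      fix x y assume xy: "x \<in> direct_sum I R" "y \<in> direct_sum I R"
      then have "x \<oplus>\<^bsub>product_ring I R\<^esub> y \<in> carrier (product_ring I R)"
        by (intro P.a_closed) (simp_all only: direct_sum_def mem_Collect_eq)
      moreover have "{i \<in> I. (x \<oplus>\<^bsub>product_ring I R\<^esub> y) i \<noteq> \<zero>\<^bsub>R i\<^esub>} =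
          {i \<in> I. x i \<oplus>\<^bsub>R i\<^esub> y i \<noteq> \<zero>\<^bsub>R i\<^esub>}"
        by auto
      ultimately show "x \<oplus>\<^bsub>product_ring I R\<^esub> y \<in> direct_sum I R"
        using xy supp_add[of x y] unfolding direct_sum_def by (simp del: product_ring_simps)
    qed
  next
    fix x y assume xy: "x \<in> direct_sum I R" "y \<in> carrier (product_ring I R)"
    then show "y \<otimes>\<^bsub>product_ring I R\<^esub> x \<in> direct_sum I R"
      by (rule mult)
    moreover have "x \<in> carrier (product_ring I R)"
      using xy(1) by (simp only: direct_sum_def mem_Collect_eq)
    ultimately show "x \<otimes>\<^bsub>product_ring I R\<^esub> y \<in> direct_sum I R"
      using P.m_comm[OF xy(2)] by simp
  qed (rule P.ring_axioms)
qed

end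

text \<open>Since the transition maps are homomorphisms, the compatible sequences form a subring of
  the product.\<close>

lemma proj_limit_cring:
  assumes cring: "\<And>n. 1 \<le> n \<Longrightarrow> cring (R n)"
    and hom: "\<And>n. 1 \<le> n \<Longrightarrow> \<phi> n \<in> ring_hom (R (Suc n)) (R n)"
  shows "cring (proj_limit R \<phi>)"
proof -
  interpret P: cring "product_ring {1..} R"
    by (rule product_ring_cring) (use cring in auto)
  let ?H = "{x \<in> carrier (product_ring {1..} R). \<forall>n\<ge>1. \<phi> n (x (Suc n)) = x n}"
  have mem: "x n \<in> carrier (R n)" if "x \<in> ?H" "1 \<le> n" for x n
    using that by (auto simp: PiE_mem)
  have "subring ?H (product_ring {1..} R)"
  proof (rule P.subringI)
    show "?H \<subseteq> carrier (product_ring {1..} R)" by blast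
    show "\<one>\<^bsub>product_ring {1..} R\<^esub> \<in> ?H"
      using P.one_closed hom by (auto simp: ring_hom_one)
  next
    fix x assume x: "x \<in> ?H"
    have "\<phi> n (\<ominus>\<^bsub>R (Suc n)\<^esub> x (Suc n)) = \<ominus>\<^bsub>R n\<^esub> x n" if n: "1 \<le> n" for n
    proof -
      have n': "1 \<le> Suc n" by simp
      interpret ring_hom_cring "R (Suc n)" "R n" "\<phi> n"
        using cring[OF n] cring[OF n'] hom[OF n]
        by (simp add: ring_hom_cring_def ring_hom_cring_axioms_def)
      show ?thesis
        using x mem[OF x n'] n by (simp add: hom_a_inv)
    qed
    then have "\<forall>n\<ge>1. \<phi> n ((\<ominus>\<^bsub>product_ring {1..} R\<^esub> x) (Suc n)) = (\<ominus>\<^bsub>product_ring {1..} R\<^esub> x) n"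
      using x by (subst (1 2) product_ring_a_inv) (auto simp: cring)
    then show "\<ominus>\<^bsub>product_ring {1..} R\<^esub> x \<in> ?H"
      using x P.a_inv_closed by blast
  next
    fix x y assume xy: "x \<in> ?H" "y \<in> ?H"
    then have "x \<otimes>\<^bsub>product_ring {1..} R\<^esub> y \<in> carrier (product_ring {1..} R)"
      "x \<oplus>\<^bsub>product_ring {1..} R\<^esub> y \<in> carrier (product_ring {1..} R)"
      by blast+
    moreover have "\<phi> n (x (Suc n) \<otimes>\<^bsub>R (Suc n)\<^esub> y (Suc n)) = x n \<otimes>\<^bsub>R n\<^esub> y n"
      "\<phi> n (x (Suc n) \<oplus>\<^bsub>R (Suc n)\<^esub> y (Suc n)) = x n \<oplus>\<^bsub>R n\<^esub> y n" if n: "1 \<le> n" for n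
      using ring_hom_mult[OF hom[OF n] mem[OF xy(1)] mem[OF xy(2)]]
        ring_hom_add[OF hom[OF n] mem[OF xy(1)] mem[OF xy(2)]] xy n by simp_all
    ultimately show "x \<otimes>\<^bsub>product_ring {1..} R\<^esub> y \<in> ?H" "x \<oplus>\<^bsub>product_ring {1..} R\<^esub> y \<in> ?H"
      by simp_all
  qed
  \<comment> \<open>\<open>proj_limit\<close> keeps the operations of the product and replaces only
    the carrier, so as a structure it is this subring.\<close>
  then show ?thesis
    unfolding proj_limit_def using P.subcringI' P.subcring_iff[of ?H] by blast
qed

section \<open>The quotient rings at each level and their transition maps\<close>

context
  fixes n :: nat
  assumes n: "1 \<le> n"
begin

lemma cring_Zpn: "p \<in> primes \<Longrightarrow> cring (Zpn_poly n p)"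
  using n by (simp add: cring_Zpn_poly)

interpretation P: cring "product_ring primes (Zpn_poly n)"
  by (rule product_ring_cring[OF cring_Zpn])

interpretation D: ideal "direct_sum primes (Zpn_poly n)" "product_ring primes (Zpn_poly n)"
  by (rule direct_sum_ideal[OF cring_Zpn])

lemma cring_A_ring: "cring (A_ring n)"
  unfolding A_ring_def by (rule D.quotient_is_cring) (rule P.is_cring)

lemma A_class_restrict:
  assumes "x \<in> carrier (product_ring primes (Zpn_poly n))"
  shows "A_class n x = direct_sum primes (Zpn_poly n) +>\<^bsub>product_ring primes (Zpn_poly n)\<^esub> x"
proof -
  have "restrict x primes = x"
    using assms by (intro extensional_restrict) (auto simp: PiE_def)
  then show ?thesis
    by (simp add: A_class_def)
qed

lemma A_class_hom: "A_class n \<in> ring_hom (product_ring primes (Zpn_poly n)) (A_ring n)"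
proof -
  note hom = D.rcos_ring_hom[folded A_ring_def]
  show ?thesis
    by (rule ring_hom_memI)
      (simp_all del: product_ring_simps add: A_class_restrict ring_hom_closed[OF hom]
        ring_hom_mult[OF hom] ring_hom_add[OF hom] ring_hom_one[OF hom])
qed

lemma A_ring_cases:
  assumes "X \<in> carrier (A_ring n)"
  obtains x where "x \<in> carrier (product_ring primes (Zpn_poly n))" "X = A_class n x"
  using assms unfolding A_ring_def FactRing_def A_RCOSETS_def'
  by (auto simp del: product_ring_simps simp: A_class_restrict)

text \<open>The difference of the two families is supported on finitely many primes, hence lies in
  the direct sum. This expresses that finitely many primes do not matter.\<close>

lemma A_class_eqI:
  assumes x: "\<And>p. prime p \<Longrightarrow> x p \<in> carrier (Zpn_poly n p)"
    and y: "\<And>p. prime p \<Longrightarrow> y p \<in> carrier (Zpn_poly n p)"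
    and fin: "finite {p. prime p \<and> x p \<noteq> y p}"
  shows "A_class n x = A_class n y"
proof -
  let ?P = "product_ring primes (Zpn_poly n)"
  let ?x = "restrict x primes" and ?y = "restrict y primes"
  have xy: "?x \<in> carrier ?P" "?y \<in> carrier ?P"
    using x y by auto
  have "(?y \<ominus>\<^bsub>?P\<^esub> ?x) p = \<zero>\<^bsub>Zpn_poly n p\<^esub>" if p: "prime p" "x p = y p" for p
  proof -
    interpret cring "Zpn_poly n p" using cring_Zpn p by simp
    show ?thesis
      using p y[OF p(1)] product_ring_minus[OF cring_Zpn xy(2,1)] by (simp add: r_right_minus_eq)
  qed
  then have "{p \<in> primes. (?y \<ominus>\<^bsub>?P\<^esub> ?x) p \<noteq> \<zero>\<^bsub>Zpn_poly n p\<^esub>} \<subseteq> {p. prime p \<and> x p \<noteq> y p}"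
    by blast
  then have "?y \<ominus>\<^bsub>?P\<^esub> ?x \<in> direct_sum primes (Zpn_poly n)"
    using fin P.minus_closed[OF xy(2,1)] unfolding direct_sum_def by (auto intro: finite_subset)
  moreover have "?y = (?y \<ominus>\<^bsub>?P\<^esub> ?x) \<oplus>\<^bsub>?P\<^esub> ?x"
    using xy P.minus_eq P.a_assoc P.l_neg P.r_zero P.a_inv_closed by metis
  ultimately have "?y \<in> direct_sum primes (Zpn_poly n) +>\<^bsub>?P\<^esub> ?x"
    unfolding a_r_coset_def' by blast
  then show ?thesis
    unfolding A_class_def by (rule D.a_repr_independence') (rule xy)
qed

lemma A_classD:
  assumes x: "x \<in> carrier (product_ring primes (Zpn_poly n))" and y: "y \<in> A_class n x"
  shows "y \<in> carrier (product_ring primes (Zpn_poly n))" "finite {p. prime p \<and> x p \<noteq> y p}"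
proof -
  let ?P = "product_ring primes (Zpn_poly n)"
  obtain d where d: "d \<in> direct_sum primes (Zpn_poly n)" "y = d \<oplus>\<^bsub>?P\<^esub> x"
    using y unfolding A_class_restrict[OF x] a_r_coset_def' by blast
  have d': "d \<in> carrier ?P" "finite {p \<in> primes. d p \<noteq> \<zero>\<^bsub>Zpn_poly n p\<^esub>}"
    using d(1) by (simp_all add: direct_sum_def)
  show "y \<in> carrier ?P"
    unfolding d(2) by (rule P.a_closed[OF d'(1) x])
  have "y p = x p" if p: "prime p" "d p = \<zero>\<^bsub>Zpn_poly n p\<^esub>" for p
  proof -
    interpret cring "Zpn_poly n p" using cring_Zpn p by simp
    have "x p \<in> carrier (Zpn_poly n p)" using x p by (auto simp: PiE_mem)
    then show ?thesis using p by (simp add: d(2))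
  qed
  then have "{p. prime p \<and> x p \<noteq> y p} \<subseteq> {p \<in> primes. d p \<noteq> \<zero>\<^bsub>Zpn_poly n p\<^esub>}"
    by auto
  then show "finite {p. prime p \<and> x p \<noteq> y p}"
    using d'(2) by (rule finite_subset)
qed

lemma mem_A_class:
  "x \<in> carrier (product_ring primes (Zpn_poly n)) \<Longrightarrow> x \<in> A_class n x"
  using D.a_rcos_self by (simp del: product_ring_simps add: A_class_restrict)

end

lemma A_class_restrict_arg: "A_class n (restrict x primes) = A_class n x"
  unfolding A_class_def by (simp only: restrict_restrict Int_absorb)

text \<open>Two representatives differ at finitely many primes only, and so do their reductions. The
  image of the coset is thus a singleton, nonempty because \<open>x\<close> lies in its own
  coset.\<close>

lemma A_transition_A_class:
  assumes n: "1 \<le> n" and x: "x \<in> carrier (product_ring primes (Zpn_poly (Suc n)))"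
  shows "A_transition n (A_class (Suc n) x) = A_class n (\<lambda>p. Zpn_reduce n p (x p))"
proof -
  have n': "1 \<le> Suc n" by simp
  have "A_class n (\<lambda>p. Zpn_reduce n p (y p)) = A_class n (\<lambda>p. Zpn_reduce n p (x p))"
    if "y \<in> A_class (Suc n) x" for y
  proof (rule A_class_eqI[OF n])
    note y = A_classD[OF n' x that]
    show "Zpn_reduce n p (y p) \<in> carrier (Zpn_poly n p)" "Zpn_reduce n p (x p) \<in> carrier (Zpn_poly n p)"
      if "prime p" for p
      using that n x y(1) by (auto intro!: Zpn_reduce_closed simp: PiE_mem)
    show "finite {p. prime p \<and> Zpn_reduce n p (y p) \<noteq> Zpn_reduce n p (x p)}"
      by (rule finite_subset[OF _ y(2)]) auto
  qed
  then have "(\<lambda>y. A_class n (\<lambda>p. Zpn_reduce n p (y p))) ` A_class (Suc n) x =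
      (\<lambda>_. A_class n (\<lambda>p. Zpn_reduce n p (x p))) ` A_class (Suc n) x"
    by (rule image_cong[OF refl])
  also have "\<dots> = {A_class n (\<lambda>p. Zpn_reduce n p (x p))}"
    by (rule image_constant) (rule mem_A_class[OF n' x])
  finally show ?thesis
    unfolding A_transition_def by (simp only: the_elem_eq)
qed

text \<open>\<open>A_class\<close> is a surjective homomorphism, and by \<open>eq\<close> the
  transition map composed with it is componentwise reduction followed by \<open>A_class\<close>,
  again a homomorphism.\<close>

lemma A_transition_hom:
  assumes n: "1 \<le> n"
  shows "A_transition n \<in> ring_hom (A_ring (Suc n)) (A_ring n)"
proof -
  have n': "1 \<le> Suc n" by simp
  let ?P = "\<lambda>n. product_ring primes (Zpn_poly n)"
  let ?r = "\<lambda>x. \<lambda>p\<in>primes. Zpn_reduce n p (x p)"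
  interpret P: cring "?P (Suc n)"
    by (rule product_ring_cring) (simp add: cring_Zpn_poly)
  note hom = Zpn_reduce_hom[OF _ n]
  have mem: "x p \<in> carrier (Zpn_poly (Suc n) p)" if "x \<in> carrier (?P (Suc n))" "prime p" for x p
    using that by (auto simp: PiE_mem)
  have r: "?r \<in> ring_hom (?P (Suc n)) (?P n)"
    by (rule ring_hom_memI)
      (auto simp: mem ring_hom_mult[OF hom] ring_hom_add[OF hom] ring_hom_one[OF hom]
         ring_hom_closed[OF hom] intro!: restrict_ext)
  have eq: "A_transition n (A_class (Suc n) x) = A_class n (?r x)" if "x \<in> carrier (?P (Suc n))" for x
    unfolding A_transition_A_class[OF n that] A_class_restrict_arg ..
  note c = A_class_hom[OF n] and c' = A_class_hom[OF n']
  show ?thesis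
  proof (rule ring_hom_memI)
    show "A_transition n \<one>\<^bsub>A_ring (Suc n)\<^esub> = \<one>\<^bsub>A_ring n\<^esub>"
      using eq[OF P.one_closed] by (simp only: ring_hom_one[OF c'] ring_hom_one[OF c] ring_hom_one[OF r])
  next
    fix X assume "X \<in> carrier (A_ring (Suc n))"
    then obtain x where x: "x \<in> carrier (?P (Suc n))" "X = A_class (Suc n) x"
      by (rule A_ring_cases[OF n'])
    show "A_transition n X \<in> carrier (A_ring n)"
      unfolding x(2) eq[OF x(1)] by (rule ring_hom_closed[OF c ring_hom_closed[OF r x(1)]])
    fix Y assume "Y \<in> carrier (A_ring (Suc n))"
    then obtain y where y: "y \<in> carrier (?P (Suc n))" "Y = A_class (Suc n) y"
      by (rule A_ring_cases[OF n'])
    note rc = ring_hom_closed[OF r x(1)] ring_hom_closed[OF r y(1)]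
    show "A_transition n (X \<otimes>\<^bsub>A_ring (Suc n)\<^esub> Y) = A_transition n X \<otimes>\<^bsub>A_ring n\<^esub> A_transition n Y"
      unfolding x(2) y(2) ring_hom_mult[OF c' x(1) y(1), symmetric] eq[OF x(1)] eq[OF y(1)]
        eq[OF P.m_closed[OF x(1) y(1)]] ring_hom_mult[OF r x(1) y(1)] ring_hom_mult[OF c rc] ..
    show "A_transition n (X \<oplus>\<^bsub>A_ring (Suc n)\<^esub> Y) = A_transition n X \<oplus>\<^bsub>A_ring n\<^esub> A_transition n Y"
      unfolding x(2) y(2) ring_hom_add[OF c' x(1) y(1), symmetric] eq[OF x(1)] eq[OF y(1)]
        eq[OF P.a_closed[OF x(1) y(1)]] ring_hom_add[OF r x(1) y(1)] ring_hom_add[OF c rc] ..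
  qed
qed

lemma cring_A_hat: "cring A_hat"
  unfolding A_hat_def by (intro proj_limit_cring cring_A_ring A_transition_hom)

interpretation A_hat: cring A_hat
  by (rule cring_A_hat)

section \<open>Elements of \<open>A_hat\<close> given by families of rational polynomials\<close>

definition integral_families :: "(nat \<Rightarrow> rat poly) set" where
  "integral_families = {f. \<forall>p. prime p \<longrightarrow> f p \<in> p_int_poly p}"

text \<open>On \<open>integral_families\<close> this respects the ring operations, as shown below,
  so computations in \<open>A_hat\<close> reduce to computations with rational polynomials at each
  prime.\<close>

definition A_hat_of_family :: "(nat \<Rightarrow> rat poly) \<Rightarrow> nat \<Rightarrow> (nat \<Rightarrow> nat \<Rightarrow> int) set" where
  "A_hat_of_family f = A_hat_proj (\<lambda>p. Zt_hat_of_poly p (f p))"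

lemma A_hat_of_family_eq:
  "A_hat_of_family f = (\<lambda>n\<in>{1..}. A_class n (\<lambda>p\<in>primes. reduce_poly p n (f p)))"
  unfolding A_hat_of_family_def A_hat_proj_def A_class_restrict_arg
  by (intro restrict_ext) (simp add: Zt_hat_of_poly_eq)

lemma A_hat_of_family_apply:
  "1 \<le> n \<Longrightarrow> A_hat_of_family f n = A_class n (\<lambda>p\<in>primes. reduce_poly p n (f p))"
  unfolding A_hat_of_family_eq by simp

lemma A_hat_of_family_restrict: "(\<lambda>n\<in>{1..}. A_hat_of_family f n) = A_hat_of_family f"
  by (rule extensional_restrict) (unfold A_hat_of_family_eq, rule restrict_extensional)

lemma reduce_family_closed:
  "f \<in> integral_families \<Longrightarrow> 1 \<le> n \<Longrightarrow>
     (\<lambda>p\<in>primes. reduce_poly p n (f p)) \<in> carrier (product_ring primes (Zpn_poly n))"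
  by (auto simp: integral_families_def reduce_poly_closed)

lemma carrier_A_hat:
  "carrier A_hat =
     {x \<in> (\<Pi>\<^sub>E n\<in>{1..}. carrier (A_ring n)). \<forall>n\<ge>1. A_transition n (x (Suc n)) = x n}"
  by (simp add: A_hat_def proj_limit_def)

lemma A_hat_ops:
  "x \<otimes>\<^bsub>A_hat\<^esub> y = (\<lambda>n\<in>{1..}. x n \<otimes>\<^bsub>A_ring n\<^esub> y n)"
  "x \<oplus>\<^bsub>A_hat\<^esub> y = (\<lambda>n\<in>{1..}. x n \<oplus>\<^bsub>A_ring n\<^esub> y n)"
  "\<one>\<^bsub>A_hat\<^esub> = (\<lambda>n\<in>{1..}. \<one>\<^bsub>A_ring n\<^esub>)"
  by (simp_all add: A_hat_def proj_limit_def product_ring_def)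

lemma A_hat_of_family_closed:
  assumes f: "f \<in> integral_families"
  shows "A_hat_of_family f \<in> carrier A_hat"
  unfolding carrier_A_hat
proof (intro CollectI conjI allI impI)
  have "A_class n (\<lambda>p\<in>primes. reduce_poly p n (f p)) \<in> carrier (A_ring n)" if "1 \<le> n" for n
    by (rule ring_hom_closed[OF A_class_hom[OF that] reduce_family_closed[OF f that]])
  then show "A_hat_of_family f \<in> (\<Pi>\<^sub>E n\<in>{1..}. carrier (A_ring n))"
    unfolding A_hat_of_family_eq restrict_PiE_iff by simp
  fix n :: nat assume n: "1 \<le> n"
  then have n': "1 \<le> Suc n" by simp
  have "A_transition n (A_hat_of_family f (Suc n)) =
      A_class n (\<lambda>p. Zpn_reduce n p ((\<lambda>p\<in>primes. reduce_poly p (Suc n) (f p)) p))"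
    unfolding A_hat_of_family_apply[OF n'] by (rule A_transition_A_class[OF n reduce_family_closed[OF f n']])
  also have "\<dots> = A_class n (\<lambda>p\<in>primes. Zpn_reduce n p ((\<lambda>p\<in>primes. reduce_poly p (Suc n) (f p)) p))"
    by (rule A_class_restrict_arg[symmetric])
  also have "(\<lambda>p\<in>primes. Zpn_reduce n p ((\<lambda>p\<in>primes. reduce_poly p (Suc n) (f p)) p)) =
      (\<lambda>p\<in>primes. reduce_poly p n (f p))"
    by (rule restrict_ext) (use f n in \<open>simp add: Zpn_reduce_reduce_poly integral_families_def\<close>)
  also have "A_class n \<dots> = A_hat_of_family f n"
    by (rule A_hat_of_family_apply[OF n, symmetric])
  finally show "A_transition n (A_hat_of_family f (Suc n)) = A_hat_of_family f n" .
qed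

lemma A_hat_of_family_add:
  assumes f: "f \<in> integral_families" and g: "g \<in> integral_families"
  shows "A_hat_of_family f \<oplus>\<^bsub>A_hat\<^esub> A_hat_of_family g = A_hat_of_family (\<lambda>p. f p + g p)"
proof -
  have "A_hat_of_family f n \<oplus>\<^bsub>A_ring n\<^esub> A_hat_of_family g n = A_hat_of_family (\<lambda>p. f p + g p) n"
    if n: "1 \<le> n" for n
  proof -
    have "(\<lambda>p\<in>primes. reduce_poly p n (f p)) \<oplus>\<^bsub>product_ring primes (Zpn_poly n)\<^esub>
        (\<lambda>p\<in>primes. reduce_poly p n (g p)) = (\<lambda>p\<in>primes. reduce_poly p n (f p + g p))"
      unfolding product_ring_simps
      by (rule restrict_ext) (use f g n in \<open>simp add: reduce_poly_add integral_families_def\<close>)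
    then show ?thesis
      unfolding A_hat_of_family_apply[OF n]
      by (simp only: ring_hom_add[OF A_class_hom[OF n] reduce_family_closed[OF f n]
            reduce_family_closed[OF g n], symmetric])
  qed
  then have "(\<lambda>n\<in>{1..}. A_hat_of_family f n \<oplus>\<^bsub>A_ring n\<^esub> A_hat_of_family g n) =
      (\<lambda>n\<in>{1..}. A_hat_of_family (\<lambda>p. f p + g p) n)"
    by (intro restrict_ext) simp
  then show ?thesis
    unfolding A_hat_ops A_hat_of_family_restrict .
qed

lemma A_hat_of_family_mult:
  assumes f: "f \<in> integral_families" and g: "g \<in> integral_families"
  shows "A_hat_of_family f \<otimes>\<^bsub>A_hat\<^esub> A_hat_of_family g = A_hat_of_family (\<lambda>p. f p * g p)"
proof -
  have "A_hat_of_family f n \<otimes>\<^bsub>A_ring n\<^esub> A_hat_of_family g n = A_hat_of_family (\<lambda>p. f p * g p) n"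
    if n: "1 \<le> n" for n
  proof -
    have "(\<lambda>p\<in>primes. reduce_poly p n (f p)) \<otimes>\<^bsub>product_ring primes (Zpn_poly n)\<^esub>
        (\<lambda>p\<in>primes. reduce_poly p n (g p)) = (\<lambda>p\<in>primes. reduce_poly p n (f p * g p))"
      unfolding product_ring_simps
      by (rule restrict_ext) (use f g n in \<open>simp add: reduce_poly_mult integral_families_def\<close>)
    then show ?thesis
      unfolding A_hat_of_family_apply[OF n]
      by (simp only: ring_hom_mult[OF A_class_hom[OF n] reduce_family_closed[OF f n]
            reduce_family_closed[OF g n], symmetric])
  qed
  then have "(\<lambda>n\<in>{1..}. A_hat_of_family f n \<otimes>\<^bsub>A_ring n\<^esub> A_hat_of_family g n) =
      (\<lambda>n\<in>{1..}. A_hat_of_family (\<lambda>p. f p * g p) n)"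
    by (intro restrict_ext) simp
  then show ?thesis
    unfolding A_hat_ops A_hat_of_family_restrict .
qed

lemma A_hat_of_family_one: "A_hat_of_family (\<lambda>p. 1) = \<one>\<^bsub>A_hat\<^esub>"
proof -
  have "A_hat_of_family (\<lambda>p. 1) n = \<one>\<^bsub>A_ring n\<^esub>" if n: "1 \<le> n" for n
  proof -
    have "(\<lambda>p\<in>primes. reduce_poly p n 1) = \<one>\<^bsub>product_ring primes (Zpn_poly n)\<^esub>"
      unfolding product_ring_simps by (rule restrict_ext) (use n in \<open>simp add: reduce_poly_one\<close>)
    then show ?thesis
      unfolding A_hat_of_family_apply[OF n] using ring_hom_one[OF A_class_hom[OF n]] by simp
  qed
  then have "(\<lambda>n\<in>{1..}. A_hat_of_family (\<lambda>p. 1) n) = (\<lambda>n\<in>{1..}. \<one>\<^bsub>A_ring n\<^esub>)"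
    by (intro restrict_ext) simp
  then show ?thesis
    unfolding A_hat_ops A_hat_of_family_restrict .
qed

text \<open>A congruence modulo p^n at every odd prime suffices: the families then differ at level n
  at most for p = 2.\<close>

lemma A_hat_of_family_eqI:
  assumes n: "1 \<le> n" and f: "f \<in> integral_families" and g: "g \<in> integral_families"
    and h: "\<And>p. prime p \<Longrightarrow> odd p \<Longrightarrow> \<exists>h\<in>p_int_poly p. f p = g p + smult (of_nat p ^ n) h"
  shows "A_hat_of_family f n = A_hat_of_family g n"
proof -
  have "A_class n (\<lambda>p\<in>primes. reduce_poly p n (f p)) = A_class n (\<lambda>p\<in>primes. reduce_poly p n (g p))"
  proof (rule A_class_eqI[OF n])
    show "(\<lambda>p\<in>primes. reduce_poly p n (f p)) p \<in> carrier (Zpn_poly n p)"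
      "(\<lambda>p\<in>primes. reduce_poly p n (g p)) p \<in> carrier (Zpn_poly n p)" if "prime p" for p
      using that n f g by (auto simp: integral_families_def reduce_poly_closed)
    have "p = 2" if p: "prime p" "reduce_poly p n (f p) \<noteq> reduce_poly p n (g p)" for p
    proof (rule ccontr)
      assume "p \<noteq> 2"
      then have "odd p"
        using p(1) prime_odd_nat[of p] prime_ge_2_nat[of p] by linarith
      then obtain h where "h \<in> p_int_poly p" "f p = g p + smult (of_nat p ^ n) h"
        using h p(1) by blast
      then show False
        using reduce_poly_cong[OF p(1) n _ _ ] g p by (auto simp: integral_families_def)
    qed
    then show "finite {p. prime p \<and>
        (\<lambda>p\<in>primes. reduce_poly p n (f p)) p \<noteq> (\<lambda>p\<in>primes. reduce_poly p n (g p)) p}"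
      by - (rule finite_subset[of _ "{2}"], auto)
  qed
  then show ?thesis
    using n by (simp add: A_hat_of_family_eq)
qed

lemma integral_families_diff: "f \<in> integral_families \<Longrightarrow> g \<in> integral_families \<Longrightarrow>
     (\<lambda>p. f p - g p) \<in> integral_families"
  by (simp add: integral_families_def p_int_poly_diff)

lemma integral_families_mult: "f \<in> integral_families \<Longrightarrow> g \<in> integral_families \<Longrightarrow>
     (\<lambda>p. f p * g p) \<in> integral_families"
  by (simp add: integral_families_def p_int_poly_mult)

lemma integral_families_power: "f \<in> integral_families \<Longrightarrow> (\<lambda>p. f p ^ i) \<in> integral_families"
  by (simp add: integral_families_def p_int_poly_power)

lemma integral_families_sum: "(\<And>i. i \<in> A \<Longrightarrow> f i \<in> integral_families) \<Longrightarrow> (\<lambda>p. \<Sum>i\<in>A. f i p) \<in> integral_families"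
  by (simp add: integral_families_def p_int_poly_sum)

lemma integral_families_of_nat: "(\<lambda>p. of_nat (c p)) \<in> integral_families"
  by (simp add: integral_families_def)

text \<open>Additivity applied to f = (f - g) + g.\<close>

lemma A_hat_of_family_diff:
  assumes f: "f \<in> integral_families" and g: "g \<in> integral_families"
  shows "A_hat_of_family f \<ominus>\<^bsub>A_hat\<^esub> A_hat_of_family g = A_hat_of_family (\<lambda>p. f p - g p)"
proof -
  have fg: "(\<lambda>p. f p - g p) \<in> integral_families"
    by (rule integral_families_diff[OF f g])
  have "A_hat_of_family f = A_hat_of_family (\<lambda>p. f p - g p) \<oplus>\<^bsub>A_hat\<^esub> A_hat_of_family g"
    unfolding A_hat_of_family_add[OF fg g] by simp
  then show ?thesis
    using A_hat_of_family_closed[OF fg] A_hat_of_family_closed[OF g]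
    by (simp add: A_hat.minus_eq A_hat.a_assoc A_hat.r_neg)
qed

lemma A_hat_of_family_power:
  fixes i :: nat
  assumes "f \<in> integral_families"
  shows "A_hat_of_family f [^]\<^bsub>A_hat\<^esub> i = A_hat_of_family (\<lambda>p. f p ^ i)"
proof (induction i)
  case (Suc i)
  then show ?case
    using A_hat_of_family_mult[OF integral_families_power[OF assms, of i] assms]
    by (simp add: mult.commute)
qed (simp add: A_hat_of_family_one)

lemma A_hat_of_family_sum:
  fixes f :: "nat \<Rightarrow> nat \<Rightarrow> rat poly"
  assumes "\<And>i. f i \<in> integral_families"
  shows "(\<Oplus>\<^bsub>A_hat\<^esub>i\<in>{..<N}. A_hat_of_family (f i)) = A_hat_of_family (\<lambda>p. \<Sum>i<N. f i p)"
proof (induction N)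
  case 0
  \<comment> \<open>The zero family is written as 1 - 1 so that the rules for differences and for 1
    yield the zero of \<open>A_hat\<close>.\<close>
  have "A_hat_of_family (\<lambda>p. 1 - 1) = \<zero>\<^bsub>A_hat\<^esub>"
    by (subst A_hat_of_family_diff[symmetric])
      (simp_all add: integral_families_def A_hat_of_family_one A_hat.minus_eq A_hat.r_neg)
  then show ?case by simp
next
  case (Suc N)
  have "(\<Oplus>\<^bsub>A_hat\<^esub>i\<in>{..<Suc N}. A_hat_of_family (f i)) =
      A_hat_of_family (f N) \<oplus>\<^bsub>A_hat\<^esub> (\<Oplus>\<^bsub>A_hat\<^esub>i\<in>{..<N}. A_hat_of_family (f i))"
    unfolding lessThan_Suc
    by (rule A_hat.finsum_insert) (auto intro: A_hat_of_family_closed assms)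
  also have "\<dots> = A_hat_of_family (\<lambda>p. \<Sum>i<Suc N. f i p)"
    unfolding Suc.IH
    by (subst A_hat_of_family_add) (auto intro: integral_families_sum assms simp: add.commute)
  finally show ?case .
qed

text \<open>The 2-component, where 2 is not invertible, has no effect on the image in \<open>\<A>\<close>-hat.\<close>

definition half_family :: "nat \<Rightarrow> rat poly" where
  "half_family p = (if odd p then [:1/2:] else 0)"

lemma half_family_integral: "half_family \<in> integral_families"
proof -
  have "1 / 2 \<in> p_int p" if "prime p" "odd p" for p
  proof -
    have "p > 2" using that prime_ge_2_nat[of p] by (cases "p = 2") auto
    then show ?thesis using p_int_inverse_of_nat[OF that(1), of 2] by simp
  qed
  then show ?thesis
    by (auto simp: integral_families_def half_family_def intro!: p_int_poly_pCons)
qed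

text \<open>The family times 2 is 1 at every odd prime, so its image is an inverse of 1 + 1, and
  inverses in a commutative ring are unique.\<close>

lemma half_hat_eq: "half_hat = A_hat_of_family half_family"
proof -
  have 2: "(\<lambda>p. 1 + 1) \<in> integral_families"
    using integral_families_of_nat[of "\<lambda>_. 2"] by simp
  have "\<one>\<^bsub>A_hat\<^esub> \<oplus>\<^bsub>A_hat\<^esub> \<one>\<^bsub>A_hat\<^esub> = A_hat_of_family (\<lambda>p. 1 + 1)"
    using integral_families_of_nat[of "\<lambda>_. 1"]
    by (subst A_hat_of_family_add[symmetric]) (simp_all add: A_hat_of_family_one)
  moreover have "A_hat_of_family (\<lambda>p. 1 + 1) \<otimes>\<^bsub>A_hat\<^esub> A_hat_of_family half_family = \<one>\<^bsub>A_hat\<^esub>"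
  proof -
    have "A_hat_of_family (\<lambda>p. (1 + 1) * half_family p) n = A_hat_of_family (\<lambda>p. 1) n" for n
    proof (cases "1 \<le> n")
      case True
      then show ?thesis
      proof (rule A_hat_of_family_eqI)
        show "(\<lambda>p. (1 + 1) * half_family p) \<in> integral_families"
          by (rule integral_families_mult[OF 2 half_family_integral])
        show "(\<lambda>p. 1) \<in> integral_families"
          using integral_families_of_nat[of "\<lambda>_. 1"] by simp
        fix p :: nat assume "prime p" "odd p"
        then show "\<exists>h\<in>p_int_poly p. (1 + 1) * half_family p = 1 + smult (of_nat p ^ n) h"
          by (intro bexI[of _ 0]) (simp_all add: half_family_def one_pCons)
      qed
    \<comment> \<open>At level 0 both sides are \<open>undefined\<close>.\<close>
    qed (simp add: A_hat_of_family_eq)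
    then show ?thesis
      unfolding A_hat_of_family_mult[OF 2 half_family_integral] A_hat_of_family_one[symmetric] ..
  qed
  ultimately show ?thesis
    unfolding half_hat_def
    using A_hat.inv_unique'[OF A_hat_of_family_closed[OF 2] A_hat_of_family_closed[OF half_family_integral]]
      A_hat.m_comm[OF A_hat_of_family_closed[OF 2] A_hat_of_family_closed[OF half_family_integral]]
    by simp
qed

lemma p_hat_eq: "p_hat = A_hat_of_family of_nat"
  unfolding p_hat_def A_hat_of_family_def ..

section \<open>Convergence of the series\<close>

definition star_sum :: "nat list \<Rightarrow> rat poly \<Rightarrow> nat \<Rightarrow> rat poly" where
  "star_sum k u c = (\<Sum>n=1..c. inner_star k u n)"

text \<open>The factor n / (n - p) is 1 / (1 - p / n). Expanding the product gives, at p^i, the sum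
  of 1 / (n_1 ... n_i) over c >= n_1 >= ... >= n_i >= a, the contribution of i leading ones. The
  bound \<open>c\<close> is kept variable for a recursion and is finally set to p - 1.\<close>

definition weighted_sum :: "nat \<Rightarrow> nat list \<Rightarrow> rat poly \<Rightarrow> nat \<Rightarrow> rat poly" where
  "weighted_sum p k u c =
     (\<Sum>a=1..c. smult (\<Prod>n=a..c. of_nat n / (of_nat n - of_nat p)) (inner_star k u a))"

context
  fixes p :: nat
  assumes p: "prime p"
begin

lemma p_int_prod: "(\<And>i. i \<in> A \<Longrightarrow> f i \<in> p_int p) \<Longrightarrow> prod f A \<in> p_int p"
  by (induction A rule: infinite_finite_induct) (auto intro: p_int_mult p simp: p)

text \<open>All denominators are products of positive integers at most n, hence prime to p.\<close>

lemma inner_star_p_int: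
  assumes "u \<in> p_int_poly p" "0 < n" "n < p"
  shows "inner_star k u n \<in> p_int_poly p"
proof -
  have "\<forall>n. 0 < n \<and> n < p \<longrightarrow> word_op w (power_seq u) n \<in> p_int_poly p" for w
  proof (induction w)
    case Nil
    then show ?case
      using assms(1) by (auto simp: power_seq_def intro!: p_int_poly_smult p_int_poly_power
          p_int_inverse_of_nat p)
  next
    case (Cons b w)
    then show ?case
      by (auto simp: letter_op_def intro!: p_int_poly_smult p_int_poly_sum p_int_inverse_of_nat p)
  qed
  then show ?thesis
    using assms(2,3) by (simp add: inner_star_def)
qed

text \<open>Downward induction on a from the empty product at a = p. With a = b + 1 and p = q + 1,
  the step is (b + 1) * (q choose b + 1) = (q - b) * (q choose b).\<close>

lemma prod_shift_eq_binomial: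
  assumes "1 \<le> a" "a \<le> p"
  shows "(\<Prod>n=a..<p. of_nat n / (of_nat n - of_nat p) :: rat) =
     (-1) ^ (p - a) * of_nat ((p - 1) choose (a - 1))"
  using assms(2,1)
proof (induction rule: inc_induct)
  case (step a)
  have "of_nat a / (of_nat a - of_nat p) * ((-1) ^ (p - Suc a) * of_nat ((p - 1) choose a)) =
      ((-1) ^ (p - a) * of_nat ((p - 1) choose (a - 1)) :: rat)"
  proof -
    obtain b where b: "a = Suc b" using step by (cases a) auto
    obtain q where q: "p = Suc q" "b < q" using step b by (cases p) auto
    have "Suc b * (q choose Suc b) = (q choose b) * (q - b)"
      using times_binomial_minus1_eq[of "Suc b" q] binomial_absorb_comp[of q b] by (simp add: mult.commute)
    then have "of_nat (Suc b) * (of_nat (q choose Suc b) :: rat) = of_nat (q choose b) * (of_nat q - of_nat b)"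
      using q(2) by (metis of_nat_diff of_nat_mult less_imp_le)
    moreover have "(-1) ^ (p - a) = (- ((-1) ^ (p - Suc a)) :: rat)"
      using step(2) by (simp add: Suc_diff_Suc[symmetric])
    moreover have "of_nat b \<noteq> (of_nat q :: rat)"
      using q(2) by simp
    \<comment> \<open>The field computation in abstract variables: A stands for a, v for b, w for q,
      where a - p = b - q.\<close>
    moreover have "A / (v - w) * (e * x) = - e * y" if "A * x = y * (w - v)" "v \<noteq> w" for A v w e x y :: rat
    proof -
      have "A / (v - w) * (e * x) = e * (A * x) / (v - w)" by simp
      also have "\<dots> = - e * y" unfolding that(1) using that(2) by (simp add: field_simps)
      finally show ?thesis .
    qed
    ultimately show ?thesis
      unfolding b q(1) by simp
  qed
  with step show ?case
    by (simp add: prod.atLeast_Suc_lessThan)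
qed simp

lemma weighted_sum_eq_star_limit: "weighted_sum p k u (p - 1) = star_limit k u p"
  unfolding weighted_sum_def star_limit_def
proof (rule sum.cong[OF refl])
  fix a assume a: "a \<in> {1..p - 1}"
  have "{a..p - 1} = {a..<p}"
    using prime_gt_0_nat[OF p] by auto
  then show "smult (\<Prod>n=a..p - 1. of_nat n / (of_nat n - of_nat p)) (inner_star k u a) =
      smult ((-1) ^ (p - a) * of_nat ((p - 1) choose (a - 1))) (inner_star k u a)"
    using a prod_shift_eq_binomial[of a] by auto
qed

text \<open>Passing to c + 1 multiplies all old weights by r = (c + 1) / (c + 1 - p), and the new
  term has weight r as well. Since 1 / r = 1 - p / (c + 1), dividing by r yields this implicit
  recursion.\<close>

lemma weighted_sum_Suc:
  assumes "Suc c < p"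
  shows "weighted_sum p k u (Suc c) =
     weighted_sum p k u c + inner_star k u (Suc c) + smult (of_nat p / of_nat (Suc c)) (weighted_sum p k u (Suc c))"
proof -
  let ?r = "of_nat (Suc c) / (of_nat (Suc c) - of_nat p) :: rat"
  have ne: "of_nat (Suc c) - of_nat p \<noteq> (0 :: rat)"
    using assms by (metis eq_iff_diff_eq_0 nat_neq_iff of_nat_eq_iff)
  have "weighted_sum p k u (Suc c) = smult ?r (weighted_sum p k u c + inner_star k u (Suc c))"
  proof -
    have "(\<Prod>n=a..Suc c. of_nat n / (of_nat n - of_nat p)) =
        ?r * (\<Prod>n=a..c. of_nat n / (of_nat n - of_nat p))" if "a \<in> {1..c}" for a
      using that by (simp del: of_nat_Suc)
    then have "(\<Sum>a=1..c. smult (\<Prod>n=a..Suc c. of_nat n / (of_nat n - of_nat p)) (inner_star k u a)) =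
        (\<Sum>a=1..c. smult ?r (smult (\<Prod>n=a..c. of_nat n / (of_nat n - of_nat p)) (inner_star k u a)))"
      by (intro sum.cong refl) (simp only: smult_smult)
    then show ?thesis
      by (simp add: weighted_sum_def smult_add_right smult_sum_right del: of_nat_Suc prod.cl_ivl_Suc)
  qed
  then have "smult (1 / ?r) (weighted_sum p k u (Suc c)) = weighted_sum p k u c + inner_star k u (Suc c)"
    using ne by simp
  moreover have "1 / ?r = 1 - of_nat p / of_nat (Suc c)"
    using ne by (simp add: divide_simps del: of_nat_Suc)
  ultimately have "weighted_sum p k u (Suc c) - smult (of_nat p / of_nat (Suc c)) (weighted_sum p k u (Suc c)) =
      weighted_sum p k u c + inner_star k u (Suc c)"
    by (simp only: smult_diff_left smult_1_left)
  then show ?thesis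
    by (simp only: diff_eq_eq)
qed

lemma star_sum_Cons_1:
  assumes "k \<noteq> []"
  shows "star_sum (1 # k) u (Suc c) = star_sum (1 # k) u c + smult (1 / of_nat (Suc c)) (star_sum k u (Suc c))"
  using assms by (simp add: star_sum_def inner_star_Cons)

lemma star_sum_p_int:
  assumes "u \<in> p_int_poly p" "c < p"
  shows "star_sum k u c \<in> p_int_poly p"
  unfolding star_sum_def using assms by (intro p_int_poly_sum p inner_star_p_int) auto

text \<open>Both \<open>weighted_sum\<close> and the truncated generating series satisfy the recursion
  \<open>F c = F (c - 1) + s c + p / c * F c\<close>, the latter with the truncation order on the
  right lowered by one. So each step gains a factor \<open>p\<close>.\<close>

lemma weighted_sum_approx:
  assumes k: "is_index k" and u: "u \<in> p_int_poly p"
  shows "c < p \<Longrightarrow> \<exists>h\<in>p_int_poly p. weighted_sum p k u c =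
     (\<Sum>i<N. smult (of_nat p ^ i) (star_sum (replicate i 1 @ k) u c)) + smult (of_nat p ^ N) h"
proof (induction N arbitrary: c)
  \<comment> \<open>Order 0 asks for p-integrality only: the denominators n - p of the weights, with
    0 < n < p, are prime to p.\<close>
  case 0
  have "weighted_sum p k u c \<in> p_int_poly p"
    unfolding weighted_sum_def
  proof (intro p_int_poly_sum p_int_poly_smult p inner_star_p_int u)
    fix a assume a: "a \<in> {1..c}"
    then show "0 < a" "a < p" using 0 by auto
    have "of_nat n / (of_nat n - of_nat p) \<in> p_int p" if "n \<in> {a..c}" for n
    proof (rule p_intI[OF p, of "int n - int p" _ "int n"])
      have "0 < n" "n < p" using that a 0 by auto
      then show "\<not> int p dvd int n - int p"
        using nat_dvd_not_less[of n p] by (metis diff_add_cancel dvd_add dvd_refl int_dvd_int_iff)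
    qed simp
    then show "(\<Prod>n=a..c. of_nat n / (of_nat n - of_nat p)) \<in> p_int p"
      by (intro p_int_prod)
  qed
  then show ?case by auto
next
  case (Suc N)
  \<comment> \<open>The induction hypothesis on the order, valid for all \<open>c\<close>; the inner
    induction on \<open>c\<close> reuses the name \<open>Suc.IH\<close>.\<close>
  note approx = Suc.IH
  have k': "is_index (replicate i 1 @ k)" for i
    using k by (auto simp: is_index_def)
  let ?G = "\<lambda>N c. \<Sum>i<N. smult (of_nat p ^ i) (star_sum (replicate i 1 @ k) u c)"
  show ?case
    using Suc.prems
  proof (induction c)
    case 0
    show ?case
      by (intro bexI[of _ 0]) (simp_all add: weighted_sum_def star_sum_def p)
  next
    case (Suc c)
    \<comment> \<open>Two errors enter: \<open>h\<close> of order \<open>Suc N\<close> at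
      \<open>c\<close>, and \<open>g\<close> of order only \<open>N\<close> at \<open>Suc c\<close>,
      which the recursion multiplies by p / (c + 1).\<close>
    obtain h where h: "h \<in> p_int_poly p"
        "weighted_sum p k u c = ?G (Suc N) c + smult (of_nat p ^ Suc N) h"
      using Suc.IH Suc.prems by auto
    obtain g where g: "g \<in> p_int_poly p"
        "weighted_sum p k u (Suc c) = ?G N (Suc c) + smult (of_nat p ^ N) g"
      using approx[OF Suc.prems] by blast
    \<comment> \<open>The term i = 0 is split off; every other term has a leading 1, so its part
      with largest variable c + 1 can be separated.\<close>
    have "?G (Suc N) (Suc c) = star_sum k u (Suc c) +
        (\<Sum>i<N. smult (of_nat p ^ Suc i) (star_sum (1 # replicate i 1 @ k) u (Suc c)))"
      by (simp only: sum.lessThan_Suc_shift) simp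
    also have "\<dots> = star_sum k u c + inner_star k u (Suc c) +
        (\<Sum>i<N. smult (of_nat p ^ Suc i) (star_sum (1 # replicate i 1 @ k) u c) +
          smult (of_nat p / of_nat (Suc c)) (smult (of_nat p ^ i) (star_sum (replicate i 1 @ k) u (Suc c))))"
      using k by (subst star_sum_Cons_1)
        (auto simp: is_index_def star_sum_def smult_add_right)
    also have "\<dots> = ?G (Suc N) c + inner_star k u (Suc c) + smult (of_nat p / of_nat (Suc c)) (?G N (Suc c))"
      by (simp only: sum.lessThan_Suc_shift sum.distrib smult_sum_right) simp
    finally have G: "?G (Suc N) (Suc c) = \<dots>" .
    have "weighted_sum p k u (Suc c) =
        ?G (Suc N) c + smult (of_nat p ^ Suc N) h + inner_star k u (Suc c) +
        smult (of_nat p / of_nat (Suc c)) (?G N (Suc c) + smult (of_nat p ^ N) g)"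
      using weighted_sum_Suc[OF Suc.prems, of k u] unfolding h(2) g(2)[symmetric] .
    \<comment> \<open>The factor p raises the error \<open>g\<close> to order \<open>Suc N\<close>,
      and the remaining 1 / (c + 1) is p-integral.\<close>
    also have "\<dots> = ?G (Suc N) (Suc c) + smult (of_nat p ^ Suc N) (h + smult (1 / of_nat (Suc c)) g)"
      unfolding G by (simp add: smult_add_right)
    finally show ?case
      using h(1) g(1) p_int_inverse_of_nat[OF p, of "Suc c"] Suc.prems
      by (intro bexI[of _ "h + smult (1 / of_nat (Suc c)) g"] p_int_poly_add p_int_poly_smult p) auto
  qed
qed

end


section \<open>The series and its limit in \<open>A_hat\<close>\<close>

lemma polylog_star_eq:
  assumes "is_index k"
  shows "polylog_star k u = A_hat_of_family (\<lambda>p. star_sum k u (p - 1))"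
proof -
  \<comment> \<open>True for p = 0 as well, by truncated subtraction, so the rewriting applies in
    every component.\<close>
  have "star_tuples p m = star_tuples (Suc (p - 1)) m" for p m
    by (simp add: star_tuples_def)
  then have "(\<Sum>ns\<in>star_tuples p (length k). smult (1 / index_power ns k) (u ^ last ns)) =
      star_sum k u (p - 1)" for p
    unfolding star_sum_def sum_star_tuples_eq_inner_star[OF assms, symmetric] by metis
  then show ?thesis
    unfolding polylog_star_def A_hat_of_family_def by simp
qed

text \<open>The zeta-star value is the polylogarithm with 1 substituted for the
  indeterminate.\<close>

lemma zeta_star_eq:
  assumes "is_index k"
  shows "zeta_star k = A_hat_of_family (\<lambda>p. star_sum k 1 (p - 1))"
proof -
  have const_sum: "[:\<Sum>x\<in>A. c x:] = (\<Sum>x\<in>A. smult (c x) (1 ^ g x))"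
    for A :: "nat list set" and c :: "_ \<Rightarrow> rat" and g :: "_ \<Rightarrow> nat"
    by (induction A rule: infinite_finite_induct) (simp_all, metis add_pCons add_0)
  have "zeta_star k = polylog_star k 1"
    unfolding zeta_star_def polylog_star_def
    by (subst const_sum[where g = last]) (rule refl)
  then show ?thesis
    by (simp add: polylog_star_eq[OF assms])
qed

lemma star_sum_integral:
  "(\<And>p. prime p \<Longrightarrow> u \<in> p_int_poly p) \<Longrightarrow> (\<lambda>p. star_sum k u (p - 1)) \<in> integral_families"
  by (auto simp: integral_families_def prime_gt_0_nat intro!: star_sum_p_int)

lemma is_index_replicate: "is_index k \<Longrightarrow> is_index (replicate i 1 @ k)"
  by (auto simp: is_index_def)

definition term_family :: "nat list \<Rightarrow> rat poly \<Rightarrow> nat \<Rightarrow> nat \<Rightarrow> rat poly" where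
  "term_family k u i p = (star_sum (replicate i 1 @ k) u (p - 1)
     - half_family p * star_sum (replicate i 1 @ k) 1 (p - 1)) * of_nat p ^ i"

context
  fixes u :: "rat poly"
  assumes u: "\<And>p. prime p \<Longrightarrow> u \<in> p_int_poly p"
begin

lemma term_family_integral: "term_family k u i \<in> integral_families"
  unfolding term_family_def [abs_def]
  by (intro integral_families_mult integral_families_diff integral_families_power
      integral_families_of_nat half_family_integral star_sum_integral u p_int_poly_1)

lemma star_series_term_eq:
  assumes "is_index k"
  shows "star_series_term k u i = A_hat_of_family (term_family k u i)"
proof -
  let ?k = "replicate i 1 @ k"
  have S: "(\<lambda>p. star_sum ?k u (p - 1)) \<in> integral_families"
    and Z: "(\<lambda>p. star_sum ?k 1 (p - 1)) \<in> integral_families"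
    by (intro star_sum_integral u p_int_poly_1; assumption)+
  note H = half_family_integral
  have N: "of_nat \<in> integral_families"
    using integral_families_of_nat[of "\<lambda>p. p"] by simp
  show ?thesis
    unfolding star_series_term_def half_hat_eq p_hat_eq polylog_star_eq[OF is_index_replicate[OF assms]]
      zeta_star_eq[OF is_index_replicate[OF assms]] A_hat_of_family_mult[OF H Z]
      A_hat_of_family_diff[OF S integral_families_mult[OF H Z]] A_hat_of_family_power[OF N]
      A_hat_of_family_mult[OF integral_families_diff[OF S integral_families_mult[OF H Z]]
        integral_families_power[OF N]] term_family_def [abs_def] ..
qed

text \<open>The approximation of order 0 has an empty partial sum and thus states p-integrality of
  the limit.\<close>

lemma star_limit_integral:
  assumes "is_index k"
  shows "star_limit k u \<in> integral_families"
  unfolding integral_families_def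
proof (intro CollectI allI impI)
  fix p :: nat assume p: "prime p"
  have "p - 1 < p" using p by (simp add: prime_gt_0_nat)
  then show "star_limit k u p \<in> p_int_poly p"
    using weighted_sum_approx[OF p assms u[OF p], of "p - 1" 0]
    unfolding weighted_sum_eq_star_limit[OF p] by simp
qed

text \<open>Truncation at N costs p^N times a p-integral polynomial in both constituents. The error
  is restated with p^n so that the level n can stay fixed while N grows.\<close>

lemma term_family_partial_sum:
  assumes p: "prime p" and k: "is_index k" and n: "n \<le> N"
  obtains h where "h \<in> p_int_poly p"
    "(\<Sum>i<N. term_family k u i p) =
       star_limit k u p - half_family p * star_limit k 1 p + smult (of_nat p ^ n) h"
proof -
  have p1: "p - 1 < p" using p by (simp add: prime_gt_0_nat)
  obtain g where g: "g \<in> p_int_poly p" "star_limit k u p =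
      (\<Sum>i<N. smult (of_nat p ^ i) (star_sum (replicate i 1 @ k) u (p - 1))) + smult (of_nat p ^ N) g"
    using weighted_sum_approx[OF p k u[OF p] p1, of N] unfolding weighted_sum_eq_star_limit[OF p] by blast
  obtain h where h: "h \<in> p_int_poly p" "star_limit k 1 p =
      (\<Sum>i<N. smult (of_nat p ^ i) (star_sum (replicate i 1 @ k) 1 (p - 1))) + smult (of_nat p ^ N) h"
    using weighted_sum_approx[OF p k p_int_poly_1[OF p] p1, of N]
    unfolding weighted_sum_eq_star_limit[OF p] by blast
  have half: "half_family p \<in> p_int_poly p"
    using half_family_integral p by (simp add: integral_families_def)
  have "term_family k u i p = smult (of_nat p ^ i) (star_sum (replicate i 1 @ k) u (p - 1))
      - half_family p * smult (of_nat p ^ i) (star_sum (replicate i 1 @ k) 1 (p - 1))" for i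
  proof -
    have "of_nat p ^ i * f = smult (of_nat p ^ i) f" for f :: "rat poly"
      by (induction i) (simp_all add: of_nat_poly mult.assoc)
    then show ?thesis
      by (simp add: term_family_def mult.commute[of _ "of_nat p ^ i"] smult_diff_right)
  qed
  then have "(\<Sum>i<N. term_family k u i p) =
      star_limit k u p - half_family p * star_limit k 1 p + smult (of_nat p ^ N) (half_family p * h - g)"
    unfolding g(2) h(2)
    by (simp add: sum_subtractf distrib_left smult_diff_right sum_distrib_left)
  also have "smult (of_nat p ^ N) (half_family p * h - g) =
      smult (of_nat p ^ n) (smult (of_nat p ^ (N - n)) (half_family p * h - g))"
    using n by (simp flip: power_add)
  finally show thesis
    by (rule that[rotated])
      (intro p_int_poly_smult p_int_poly_diff p_int_poly_mult p_int_power p_int_of_nat p half g h)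
qed

text \<open>Convergence is componentwise with discrete components: at level n the partial sums are
  constant from N = n on. The limit is given by any \<open>G\<close> with the right values at odd
  primes, so that two series can share one representative.\<close>

lemma star_series_sums:
  assumes k: "is_index k" and G: "G \<in> integral_families"
    and eq: "\<And>p. prime p \<Longrightarrow> odd p \<Longrightarrow> G p = star_limit k u p - half_family p * star_limit k 1 p"
  shows "A_hat_sums (star_series_term k u) (A_hat_of_family G)"
proof -
  let ?S = "\<lambda>N p. \<Sum>i<N. term_family k u i p"
  have S: "?S N \<in> integral_families" for N
    by (intro integral_families_sum term_family_integral)
  have carr: "A_hat_of_family f \<in> (\<Pi>\<^sub>E n\<in>{1..}. carrier (A_ring n))" if "f \<in> integral_families" for f
    using A_hat_of_family_closed[OF that] by (simp only: carrier_A_hat mem_Collect_eq)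
  have stable: "A_hat_of_family (?S N) n = A_hat_of_family G n" if n: "1 \<le> n" and N: "n \<le> N" for n N
  proof (rule A_hat_of_family_eqI[OF n S G])
    fix p :: nat assume p: "prime p" "odd p"
    show "\<exists>h\<in>p_int_poly p. ?S N p = G p + smult (of_nat p ^ n) h"
      unfolding eq[OF p] using term_family_partial_sum[OF p(1) k N] by blast
  qed
  have lim: "limitin (discrete_topology (carrier (A_ring n))) (\<lambda>N. A_hat_of_family (?S N) n)
      (A_hat_of_family G n) sequentially" if n: "n \<in> {1..}" for n
  proof -
    have "eventually (\<lambda>N. A_hat_of_family (?S N) n = A_hat_of_family G n) sequentially"
      using stable n unfolding eventually_sequentially by auto
    moreover have "A_hat_of_family G n \<in> carrier (A_ring n)"
      using carr[OF G] n by (rule PiE_mem)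
    ultimately show ?thesis
      unfolding limitin_def by (auto elim: eventually_mono)
  qed
  have "limitin A_hat_topology (\<lambda>N. A_hat_of_family (?S N)) (A_hat_of_family G) sequentially"
    unfolding A_hat_topology_def proj_limit_topology_def A_hat_def[symmetric]
      limitin_subtopology limitin_componentwise topspace_product_topology topspace_discrete_topology
    using A_hat_of_family_closed[OF G] A_hat_of_family_closed[OF S] carr[OF S] carr[OF G] lim
    by (simp add: PiE_def)
  then show ?thesis
    unfolding A_hat_sums_def star_series_term_eq[OF k] A_hat_of_family_sum[OF term_family_integral] .
qed

end

theorem theorem1p5:
  fixes k :: "nat list"
  assumes "is_index k"
  shows "\<exists>S. A_hat_sums (star_series_term k [:0, 1:]) S \<and>
             A_hat_sums (star_series_term (hoffman_dual k) [:1, -1:]) S"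
proof -
  let ?t = "[:0, 1:] :: rat poly" and ?l = "hoffman_dual k"
  \<comment> \<open>The common sum of both series, written in terms of \<open>k\<close>.\<close>
  let ?G = "\<lambda>p. star_limit k ?t p - half_family p * star_limit k 1 p"
  have t: "?t \<in> p_int_poly p" "[:1, -1:] \<in> p_int_poly p" if "prime p" for p
    using that p_int_uminus[OF that p_int_1[OF that]] by (auto intro!: p_int_poly_pCons)
  have G: "?G \<in> integral_families"
    by (intro integral_families_diff integral_families_mult half_family_integral
        star_limit_integral assms t p_int_poly_1)
  \<comment> \<open>For odd p \<open>half_family p\<close> is the constant 1/2 and [:1, -1:] is 1 -
    t, so this is \<open>star_limit_duality\<close>.\<close>
  have "?G p = star_limit ?l [:1, -1:] p - half_family p * star_limit ?l 1 p" if "odd p" for p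
    using star_limit_duality[OF that, of k ?t] that by (simp add: half_family_def one_pCons)
  then show ?thesis
    using star_series_sums[OF t(1) assms G] star_series_sums[OF t(2) is_index_hoffman_dual G]
    by blast
qed

end
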